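(* For the discrete-time infinite horizon market model with one log-normal stock described in the context, the following assertions hold: (a) exactly one of the conditions NAA or SAA is satisfied, and $$ \mathrm{NAA}\iff\mathsf P(V_\infty<\infty)=1,\qquad \mathrm{SAA}\iff\mathsf P(V_\infty=\infty)=1.$$ (b) If the condition $$\lim_{k\to\infty}\sigma_k I_{\left\{0<\mu_k\le \frac{1}{2}(1+\varepsilon)\sigma_k^2\right\}}=0$$ is satisfied for some $\varepsilon\in (0,1)$, then (for this $\varepsilon$) $$ \mathrm{NAA} \iff \Sigma_\infty(\varepsilon)<\infty;\qquad \mathrm{SAA} \iff \Sigma_\infty(\varepsilon)=\infty.$$
   Context: $(\xi_k)_{k\ge1}$ are independent standard normal random variables on a probability space $(\Omega,\mathcal F,\mathsf P)$, $\mathcal F=\sigma(\xi_k,\ k\ge1)$, $\mathcal F_n=\sigma(\xi_1,\dots,\xi_n)$ ($\mathcal F_0$ trivial). The stock price is $S_0=1$, $S_n=S_{n-1}(1+R_n)$, $R_n=\exp(\mu_n-\sigma_n^2/2+\sigma_n\xi_n)-1$, $n\ge1$, where $\mu_k\in\mathbb R$, $\sigma_k>0$ are non-random sequences. The $n$-th small market is defined on $(\Omega,\mathcal F_n,\mathsf P)$ with times $\{0,\dots,n\}$ and the set $\mathcal X^n$ of value processes $X=(X_k)_{k=0}^n$ of the form $X_0=x$ (constant), $X_k=X_{k-1}(1+\delta_kR_k)\ge0$, $k=1,\dots,n$, where $\delta_k\in[0,1]$ is predictable ($\mathcal F_{k-1}$-measurable). NAA (no asymptotic arbitrage): for any sequence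 $X^n\in\mathcal X^n$, $X^n_0\to0$ implies $\limsup_{n\to\infty}\mathsf P(X^n_n\ge1)=0$. SAA (strong asymptotic arbitrage): there is a sequence $X^n\in\mathcal X^n$ with $X^n_0\to0$ and $\limsup_{n\to\infty}\mathsf P(X^n_n\ge1)=1$. $\delta^*_k$ is the (non-random) solution of the optimization problem $\mathsf E\ln(1+\delta R_k)\to\max_{0\le\delta\le1}$, and $V_n=\prod_{k=1}^n(1+\delta^*_kR_k)$. $V_\infty$ denotes the a.s. limit of $V_n$ in $(0,+\infty]$ (which exists because $1/V_n$ is a positive supermartingale). For $\varepsilon>0$, $$\Sigma^1_n(\varepsilon)=\sum_{k=1}^n\left(\frac{\mu_k}{\sigma_k}\right)^2I_{\{0<\mu_k\le\frac12(1+\varepsilon)\sigma_k^2\}},\quad \Sigma^2_n(\varepsilon)=\sum_{k=1}^n\mu_kI_{\{\mu_k>\frac12(1+\varepsilon)\sigma_k^2\}},$$ $\Sigma_n(\varepsilon)=\Sigma^1_n(\varepsilon)+\Sigma^2_n(\varepsilon)$, and the subscript $\infty$ denotes the limit as $n\to\infty$ (in $[0,+\infty]$). $I_{\{\cdot\}}$ is the indicator. *)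

theory Defs
  imports "HOL-Probability.Probability"
begin

text \<open>
  Sequences whose mathematical index set is \<open>{1, 2, \<dots>}\<close> are functions on \<^typ>\<open>nat\<close>; their value at
  \<open>0\<close> is never used.
\<close>

text \<open>The sigma-algebra on \<^term>\<open>space M\<close> generated by \<open>\<xi> i\<close>, \<open>i \<in> I\<close>; trivial if \<open>I\<close> is empty.\<close>

definition generated_by :: "'a measure \<Rightarrow> (nat \<Rightarrow> 'a \<Rightarrow> real) \<Rightarrow> nat set \<Rightarrow> 'a measure" where
  "generated_by M \<xi> I = sigma (space M) {\<xi> i -` A \<inter> space M | i A. i \<in> I \<and> A \<in> sets borel}"

definition simple_return ::
    "(nat \<Rightarrow> real) \<Rightarrow> (nat \<Rightarrow> real) \<Rightarrow> (nat \<Rightarrow> 'a \<Rightarrow> real) \<Rightarrow> nat \<Rightarrow> 'a \<Rightarrow> real" where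
  "simple_return \<mu> \<sigma> \<xi> n \<omega> = exp (\<mu> n - (\<sigma> n)\<^sup>2 / 2 + \<sigma> n * \<xi> n \<omega>) - 1"

text \<open>
  Value processes of the \<open>n\<close>-th small market with initial capital \<open>x\<close>. Only the times \<open>0, \<dots>, n\<close> and
  the points of \<^term>\<open>space M\<close> matter.
\<close>

definition value_processes ::
    "'a measure \<Rightarrow> (nat \<Rightarrow> real) \<Rightarrow> (nat \<Rightarrow> real) \<Rightarrow> (nat \<Rightarrow> 'a \<Rightarrow> real) \<Rightarrow> nat \<Rightarrow> real \<Rightarrow>
      (nat \<Rightarrow> 'a \<Rightarrow> real) set" where
  "value_processes M \<mu> \<sigma> \<xi> n x =
    {X. (\<forall>\<omega>\<in>space M. X 0 \<omega> = x) \<and>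
        (\<exists>\<delta>. \<forall>k\<in>{1..n}.
           \<delta> k \<in> borel_measurable (generated_by M \<xi> {1..k - 1}) \<and>
           (\<forall>\<omega>\<in>space M. \<delta> k \<omega> \<in> {0..1} \<and>
              X k \<omega> = X (k - 1) \<omega> * (1 + \<delta> k \<omega> * simple_return \<mu> \<sigma> \<xi> k \<omega>) \<and>
              X k \<omega> \<ge> 0))}"

definition NAA ::
    "'a measure \<Rightarrow> (nat \<Rightarrow> real) \<Rightarrow> (nat \<Rightarrow> real) \<Rightarrow> (nat \<Rightarrow> 'a \<Rightarrow> real) \<Rightarrow> bool" where
  "NAA M \<mu> \<sigma> \<xi> \<longleftrightarrow>
    (\<forall>x X. (\<forall>n\<ge>1. X n \<in> value_processes M \<mu> \<sigma> \<xi> n (x n)) \<longrightarrow> x \<longlonglongrightarrow> 0 \<longrightarrow>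
       limsup (\<lambda>n. ereal (\<P>(\<omega> in M. X n n \<omega> \<ge> 1))) = 0)"

definition SAA ::
    "'a measure \<Rightarrow> (nat \<Rightarrow> real) \<Rightarrow> (nat \<Rightarrow> real) \<Rightarrow> (nat \<Rightarrow> 'a \<Rightarrow> real) \<Rightarrow> bool" where
  "SAA M \<mu> \<sigma> \<xi> \<longleftrightarrow>
    (\<exists>x X. (\<forall>n\<ge>1. X n \<in> value_processes M \<mu> \<sigma> \<xi> n (x n)) \<and> x \<longlonglongrightarrow> 0 \<and>
       limsup (\<lambda>n. ereal (\<P>(\<omega> in M. X n n \<omega> \<ge> 1))) = 1)"

text \<open>
  The maximizer exists and is unique when \<open>\<xi> k\<close> is standard normal and \<open>\<sigma> k > 0\<close>, since the objective
  is then finite, continuous and strictly concave on \<open>[0, 1]\<close>.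
\<close>

definition opt_fraction ::
    "'a measure \<Rightarrow> (nat \<Rightarrow> real) \<Rightarrow> (nat \<Rightarrow> real) \<Rightarrow> (nat \<Rightarrow> 'a \<Rightarrow> real) \<Rightarrow> nat \<Rightarrow> real" where
  "opt_fraction M \<mu> \<sigma> \<xi> k =
    arg_max (\<lambda>\<delta>. \<integral>\<omega>. ln (1 + \<delta> * simple_return \<mu> \<sigma> \<xi> k \<omega>) \<partial>M) (\<lambda>\<delta>. 0 \<le> \<delta> \<and> \<delta> \<le> 1)"

definition opt_value ::
    "'a measure \<Rightarrow> (nat \<Rightarrow> real) \<Rightarrow> (nat \<Rightarrow> real) \<Rightarrow> (nat \<Rightarrow> 'a \<Rightarrow> real) \<Rightarrow> nat \<Rightarrow> 'a \<Rightarrow> real" where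
  "opt_value M \<mu> \<sigma> \<xi> n \<omega> = (\<Prod>k=1..n. 1 + opt_fraction M \<mu> \<sigma> \<xi> k * simple_return \<mu> \<sigma> \<xi> k \<omega>)"

text \<open>
  The limit exists for almost all \<open>\<omega>\<close>; on the exceptional null set \<^const>\<open>lim\<close> is an unspecified value.
\<close>

definition opt_value_limit ::
    "'a measure \<Rightarrow> (nat \<Rightarrow> real) \<Rightarrow> (nat \<Rightarrow> real) \<Rightarrow> (nat \<Rightarrow> 'a \<Rightarrow> real) \<Rightarrow> 'a \<Rightarrow> ereal" where
  "opt_value_limit M \<mu> \<sigma> \<xi> \<omega> = lim (\<lambda>n. ereal (opt_value M \<mu> \<sigma> \<xi> n \<omega>))"

definition Sigma1 :: "(nat \<Rightarrow> real) \<Rightarrow> (nat \<Rightarrow> real) \<Rightarrow> real \<Rightarrow> nat \<Rightarrow> real" where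
  "Sigma1 \<mu> \<sigma> \<epsilon> n = (\<Sum>k=1..n. (\<mu> k / \<sigma> k)\<^sup>2 * indicator {0<..1/2 * (1 + \<epsilon>) * (\<sigma> k)\<^sup>2} (\<mu> k))"

definition Sigma2 :: "(nat \<Rightarrow> real) \<Rightarrow> (nat \<Rightarrow> real) \<Rightarrow> real \<Rightarrow> nat \<Rightarrow> real" where
  "Sigma2 \<mu> \<sigma> \<epsilon> n = (\<Sum>k=1..n. \<mu> k * indicator {1/2 * (1 + \<epsilon>) * (\<sigma> k)\<^sup>2<..} (\<mu> k))"

definition Sigma_total :: "(nat \<Rightarrow> real) \<Rightarrow> (nat \<Rightarrow> real) \<Rightarrow> real \<Rightarrow> nat \<Rightarrow> real" where
  "Sigma_total \<mu> \<sigma> \<epsilon> n = Sigma1 \<mu> \<sigma> \<epsilon> n + Sigma2 \<mu> \<sigma> \<epsilon> n"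

definition Sigma_limit :: "(nat \<Rightarrow> real) \<Rightarrow> (nat \<Rightarrow> real) \<Rightarrow> real \<Rightarrow> ereal" where
  "Sigma_limit \<mu> \<sigma> \<epsilon> = lim (\<lambda>n. ereal (Sigma_total \<mu> \<sigma> \<epsilon> n))"

end

theory Submission
  imports Defs
begin

text \<open>
  The portfolio \<open>V\<close> that invests the log-optimal fraction in every period decides the matter, because
  it is a numeraire: the first-order condition for the optimal fraction says that every other constant
  fraction has expected one-step return at most one relative to it (\<open>expectation_ratio_le_1\<close>), and
  independence of the periods extends this to predictable fractions. So \<open>X n / V n\<close> has expectation at
  most the initial capital for every value process (\<open>expectation_relative_value\<close>). If \<open>V\<close> converges to
  a finite limit, Markov's inequality therefore rules out asymptotic arbitrage
  (\<open>NAA_of_convergent_V\<close>). If \<open>V\<close> tends to infinity, scaling \<open>V\<close> by a slowly vanishing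
  initial capital is a strong asymptotic arbitrage (\<open>SAA_of_divergent_wealth\<close>).

  One of the two cases occurs almost surely. Indeed \<open>1 / V n\<close> is a product of independent positive
  factors, each with expectation at most one, and such products obey Kakutani's dichotomy: with \<open>a k\<close>
  the expectation of the square root of the \<open>k\<close>-th factor, the product has a positive limit if the
  series of \<open>1 - a k\<close> converges (\<open>prod_indep_tendsto_pos\<close>, through Kolmogorov's one-series theorem)
  and tends to zero otherwise (\<open>prod_indep_tendsto_zero\<close>, through Doob's maximal inequality).

  For the explicit criterion the optimal fraction need not be known. The number \<open>1 - a k\<close> is at most half
  of the optimal expected log-growth, which is bounded by the drift (Jensen) and by half the squared
  ratio \<open>\<mu> k / \<sigma> k\<close> (Girsanov). These bounds match the two kinds of summands of \<open>\<Sigma>\<close>, so a finite sum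
  gives convergence of \<open>V\<close>. If the sum is infinite, a strategy with explicit fractions has wealth whose
  negative moment of order \<open>\<epsilon> / 2\<close> tends to zero (\<open>SAA_of_not_summable\<close>); this is where the condition
  that the volatility vanishes along the periods of small drift enters. As \<open>NAA\<close> and \<open>SAA\<close> exclude
  each other, these implications are equivalences.
\<close>

section \<open>Independence from the past\<close>

lemma space_generated_by [simp]: "space (generated_by M X I) = space M"
  by (simp add: generated_by_def space_measure_of_conv)

lemma sets_generated_by:
  "sets (generated_by M X I) =
    sigma_sets (space M) (\<Union>i\<in>I. {X i -` A \<inter> space M | A. A \<in> sets borel})"
proof -
  have "{X i -` A \<inter> space M | i A. i \<in> I \<and> A \<in> sets borel} =
      (\<Union>i\<in>I. {X i -` A \<inter> space M | A. A \<in> sets borel})"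
    by blast
  then show ?thesis
    unfolding generated_by_def by (subst sets_measure_of) auto
qed

lemma sets_generated_by_subset:
  assumes "\<And>i. i \<in> I \<Longrightarrow> X i \<in> borel_measurable M"
  shows "sets (generated_by M X I) \<subseteq> sets M"
  unfolding sets_generated_by
  by (intro sets.sigma_sets_subset) (auto intro: measurable_sets assms)

lemma sets_generated_by_mono:
  "I \<subseteq> J \<Longrightarrow> sets (generated_by M X I) \<subseteq> sets (generated_by M X J)"
  unfolding sets_generated_by by (intro sigma_sets_mono' UN_mono) auto

lemma borel_measurable_generated_by_imp:
  assumes "\<And>i. i \<in> I \<Longrightarrow> X i \<in> borel_measurable M"
    and "G \<in> borel_measurable (generated_by M X I)"
  shows "G \<in> borel_measurable M"
  by (rule measurable_from_subalg[OF _ assms(2)])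
     (simp add: subalgebra_def sets_generated_by_subset assms(1))

lemma borel_measurable_generated_by_mono:
  assumes "I \<subseteq> J" "G \<in> borel_measurable (generated_by M X I)"
  shows "G \<in> borel_measurable (generated_by M X J)"
  by (rule measurable_from_subalg[OF _ assms(2)])
     (simp add: subalgebra_def sets_generated_by_mono[OF assms(1)])

lemma borel_measurable_generated_by_component:
  assumes "i \<in> I"
  shows "X i \<in> borel_measurable (generated_by M X I)"
proof (rule measurableI)
  fix A :: "real set" assume "A \<in> sets borel"
  then show "X i -` A \<inter> space (generated_by M X I) \<in> sets (generated_by M X I)"
    unfolding sets_generated_by using assms by (auto intro!: sigma_sets.Basic)
qed simp

text \<open>
  Independence of a family is inherited by the sigma-algebras generated by disjoint blocks of it. This
  is how past and present meet throughout: \<open>G\<close> depends on earlier periods, \<open>h (X j)\<close> on the period \<open>j\<close>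
  alone, so expectations of products factorise.
\<close>

lemma (in prob_space) indep_var_generated_by:
  fixes h :: "real \<Rightarrow> 'c::topological_space"
  assumes indep: "indep_vars (\<lambda>_. borel) X K"
    and I: "I \<subseteq> K" "j \<in> K" "j \<notin> I"
    and G: "G \<in> borel_measurable (generated_by M X I)"
    and h: "h \<in> borel_measurable borel"
  shows "indep_var borel G borel (\<lambda>\<omega>. h (X j \<omega>))"
proof -
  let ?E = "\<lambda>i. {X i -` A \<inter> space M | A. A \<in> sets borel}"
  have X: "X i \<in> borel_measurable M" if "i \<in> K" for i
    using indep that by (auto simp: indep_vars_def2)
  have "indep_sets (\<lambda>b. sigma_sets (space M) (\<Union>i\<in>case_bool I {j} b. ?E i)) UNIV"
  proof (rule indep_sets_collect_sigma)
    show "indep_sets ?E (\<Union>b\<in>UNIV. case_bool I {j} b)"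
      using indep I unfolding indep_vars_def2
      by (auto simp: UNIV_bool intro: indep_sets_mono_index)
    show "disjoint_family (case_bool I {j})"
      using I by (auto simp: disjoint_family_on_def split: bool.split)
    show "Int_stable (?E i)" for i
    proof (rule Int_stableI)
      fix a b assume "a \<in> ?E i" "b \<in> ?E i"
      then obtain A B where "a = X i -` A \<inter> space M" "b = X i -` B \<inter> space M"
        "A \<in> sets borel" "B \<in> sets borel" by auto
      then show "a \<inter> b \<in> ?E i"
        by (intro CollectI exI[of _ "A \<inter> B"]) auto
    qed
  qed
  then have *: "indep_set (sets (generated_by M X I)) (sigma_sets (space M) (?E j))"
    unfolding indep_set_def sets_generated_by
    by (rule indep_sets_mono_sets) (auto split: bool.split)
  have GM: "random_variable borel G"
    by (rule borel_measurable_generated_by_imp[OF X G]) (use I in auto)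
  have hM: "random_variable borel (\<lambda>\<omega>. h (X j \<omega>))"
    using h X[OF I(2)] by measurable
  have 1: "sigma_sets (space M) {G -` A \<inter> space M | A. A \<in> sets borel} \<subseteq> sets (generated_by M X I)"
    using sets.sigma_sets_subset[of "{G -` A \<inter> space M | A. A \<in> sets borel}" "generated_by M X I"]
      measurable_sets[OF G] by auto
  have 2: "sigma_sets (space M) {(\<lambda>\<omega>. h (X j \<omega>)) -` A \<inter> space M | A. A \<in> sets borel}
      \<subseteq> sigma_sets (space M) (?E j)"
  proof (rule sigma_sets_mono', safe)
    fix A :: "'c set" assume "A \<in> sets borel"
    then have "h -` A \<in> sets borel"
      using measurable_sets[OF h, of A] by simp
    then show "\<exists>B. (\<lambda>\<omega>. h (X j \<omega>)) -` A \<inter> space M = X j -` B \<inter> space M \<and> B \<in> sets borel"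
      by (intro exI[of _ "h -` A"]) auto
  qed
  show ?thesis
    unfolding indep_var_eq
  proof (intro conjI GM hM)
    show "indep_set (sigma_sets (space M) {G -` A \<inter> space M | A. A \<in> sets borel})
        (sigma_sets (space M) {(\<lambda>\<omega>. h (X j \<omega>)) -` A \<inter> space M | A. A \<in> sets borel})"
      using * unfolding indep_set_def
      by (rule indep_sets_mono_sets) (use 1 2 in \<open>auto split: bool.split\<close>)
  qed
qed

lemma (in prob_space) indep_var_nn_integral_mult:
  fixes G H :: "'a \<Rightarrow> ennreal"
  assumes "indep_var borel G borel H"
  shows "(\<integral>\<^sup>+\<omega>. G \<omega> * H \<omega> \<partial>M) = (\<integral>\<^sup>+\<omega>. G \<omega> \<partial>M) * (\<integral>\<^sup>+\<omega>. H \<omega> \<partial>M)"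
proof -
  have "(\<lambda>_::bool. borel :: ennreal measure) = case_bool borel borel"
    by (auto split: bool.split)
  then have "indep_vars (\<lambda>_. borel) (case_bool G H) UNIV"
    using assms unfolding indep_var_def by simp
  from indep_vars_nn_integral[OF _ this] show ?thesis
    by (simp add: UNIV_bool mult.commute)
qed

section \<open>The maximal inequality and convergence of random series\<close>

text \<open>
  Doob's maximal inequality over an infinite horizon. The event splits according to the first index
  \<open>n\<close> with \<open>X n \<ge> c\<close>; the \<open>n\<close>-th piece belongs to \<open>F n\<close>, so the submartingale property replaces
  \<open>X n\<close> on it by a common later \<open>X N\<close>, and the pieces together cost at most the expectation of \<open>X N\<close>.
\<close>

lemma maximal_inequality:
  fixes X :: "nat \<Rightarrow> 'a \<Rightarrow> ennreal" and F :: "nat \<Rightarrow> 'a measure"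
  assumes F: "\<And>n. space (F n) = space M" "\<And>n. sets (F n) \<subseteq> sets M"
      "\<And>m n. m \<le> n \<Longrightarrow> sets (F m) \<subseteq> sets (F n)"
    and X: "\<And>n. X n \<in> borel_measurable (F n)"
    and sub: "\<And>n A. A \<in> sets (F n) \<Longrightarrow>
      (\<integral>\<^sup>+\<omega>. X n \<omega> * indicator A \<omega> \<partial>M) \<le> (\<integral>\<^sup>+\<omega>. X (Suc n) \<omega> * indicator A \<omega> \<partial>M)"
    and B: "\<And>n. (\<integral>\<^sup>+\<omega>. X n \<omega> \<partial>M) \<le> B"
  shows "c * emeasure M {\<omega>\<in>space M. \<exists>n. X n \<omega> \<ge> c} \<le> B"
proof -
  define E where "E n = {\<omega>\<in>space M. X n \<omega> \<ge> c}" for n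
  have E: "E n \<in> sets (F n)" for n
    using measurable_sets[OF X, of "{c..}" n] F(1) by (simp add: E_def vimage_def Int_def conj_commute)
  have DF: "disjointed E n \<in> sets (F n)" for n
    unfolding disjointed_def
    by (intro sets.Diff E sets.finite_UN subsetD[OF F(3) E]) auto
  then have D: "disjointed E n \<in> sets M" for n
    using F(2) by auto
  have XM: "X n \<in> borel_measurable M" for n
    by (rule measurable_from_subalg[OF _ X]) (simp add: subalgebra_def F)
  have sub': "(\<integral>\<^sup>+\<omega>. X n \<omega> * indicator A \<omega> \<partial>M) \<le> (\<integral>\<^sup>+\<omega>. X N \<omega> * indicator A \<omega> \<partial>M)"
    if "n \<le> N" "A \<in> sets (F n)" for n N A
    using that(1)
  proof (induction rule: dec_induct)
    case (step k)
    moreover have "A \<in> sets (F k)" using F(3)[OF step(1)] that(2) by auto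
    ultimately show ?case using sub order_trans by blast
  qed simp
  have part: "(\<Sum>n<N. c * emeasure M (disjointed E n)) \<le> B" for N
  proof -
    have "(\<Sum>n<N. c * emeasure M (disjointed E n)) =
        (\<Sum>n<N. \<integral>\<^sup>+\<omega>. c * indicator (disjointed E n) \<omega> \<partial>M)"
      using D by (simp add: nn_integral_cmult_indicator)
    also have "\<dots> \<le> (\<Sum>n<N. \<integral>\<^sup>+\<omega>. X n \<omega> * indicator (disjointed E n) \<omega> \<partial>M)"
      using disjointed_subset[of E]
      by (intro sum_mono nn_integral_mono) (auto simp: E_def split: split_indicator)
    also have "\<dots> \<le> (\<Sum>n<N. \<integral>\<^sup>+\<omega>. X N \<omega> * indicator (disjointed E n) \<omega> \<partial>M)"
      by (intro sum_mono sub' DF) auto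
    also have "\<dots> = (\<integral>\<^sup>+\<omega>. X N \<omega> * (\<Sum>n<N. indicator (disjointed E n) \<omega>) \<partial>M)"
      using D XM by (simp add: sum_distrib_left flip: nn_integral_sum)
    also have "\<dots> \<le> (\<integral>\<^sup>+\<omega>. X N \<omega> * 1 \<partial>M)"
    proof (intro nn_integral_mono mult_left_mono)
      fix \<omega>
      have "disjoint_family_on (disjointed E) {..<N}"
        using disjoint_family_disjointed[of E] by (rule disjoint_family_on_mono[rotated]) simp
      then have "(\<Sum>n<N. indicator (disjointed E n) \<omega>) = (indicator (\<Union>n<N. disjointed E n) \<omega> :: ennreal)"
        by (simp add: indicator_UN_disjoint)
      then show "(\<Sum>n<N. indicator (disjointed E n) \<omega>) \<le> (1::ennreal)"
        by (simp add: indicator_def)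
    qed simp
    finally show ?thesis using B[of N] by simp
  qed
  have "{\<omega>\<in>space M. \<exists>n. X n \<omega> \<ge> c} = (\<Union>n. disjointed E n)"
    by (auto simp: UN_disjointed_eq E_def)
  then have "c * emeasure M {\<omega>\<in>space M. \<exists>n. X n \<omega> \<ge> c} = (\<Sum>n. c * emeasure M (disjointed E n))"
    using D disjoint_family_disjointed[of E]
    by (simp add: suminf_emeasure[symmetric] subset_eq image_iff)
  also have "\<dots> \<le> B"
    by (rule suminf_le_const[OF summableI part])
  finally show ?thesis .
qed

lemma (in prob_space) integrable_of_square:
  fixes f :: "'a \<Rightarrow> real"
  assumes "f \<in> borel_measurable M" "integrable M (\<lambda>x. (f x)\<^sup>2)"
  shows "integrable M f"
  using square_integrable_imp_integrable[OF assms] finite_measure_axioms by simp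

lemma integrable_square_add:
  fixes f g :: "'a \<Rightarrow> real"
  assumes "f \<in> borel_measurable M" "g \<in> borel_measurable M"
    and "integrable M (\<lambda>x. (f x)\<^sup>2)" "integrable M (\<lambda>x. (g x)\<^sup>2)"
  shows "integrable M (\<lambda>x. (f x + g x)\<^sup>2)"
proof (rule Bochner_Integration.integrable_bound)
  show "integrable M (\<lambda>x. 2 * (f x)\<^sup>2 + 2 * (g x)\<^sup>2)"
    using assms(3,4) by auto
  have "(f x + g x)\<^sup>2 \<le> 2 * (f x)\<^sup>2 + 2 * (g x)\<^sup>2" for x
    using sum_squares_bound[of "f x" "g x"] by (simp add: power2_sum)
  then show "AE x in M. norm ((f x + g x)\<^sup>2) \<le> norm (2 * (f x)\<^sup>2 + 2 * (g x)\<^sup>2)"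
    by simp
qed (use assms(1,2) in measurable)

text \<open>
  The mixed term of the square has expectation zero on every event of the past, because the new summand
  is centred and independent of the past. Hence squares of partial sums form a submartingale, and
  their expectations add up variances.
\<close>

lemma (in prob_space) indep_centred_increment:
  fixes X :: "nat \<Rightarrow> 'a \<Rightarrow> real"
  assumes indep: "indep_vars (\<lambda>_. borel) X {1..}"
    and int: "\<And>k. k \<ge> 1 \<Longrightarrow> integrable M (\<lambda>\<omega>. (X k \<omega>)\<^sup>2)"
    and cent: "\<And>k. k \<ge> 1 \<Longrightarrow> expectation (X k) = 0"
    and S: "S \<in> borel_measurable (generated_by M X {1..n})" "integrable M (\<lambda>\<omega>. (S \<omega>)\<^sup>2)"
    and A: "A \<in> sets (generated_by M X {1..n})"
  shows "(\<integral>\<^sup>+\<omega>. ennreal ((S \<omega> + X (Suc n) \<omega>)\<^sup>2) * indicator A \<omega> \<partial>M) =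
    (\<integral>\<^sup>+\<omega>. ennreal ((S \<omega>)\<^sup>2) * indicator A \<omega> \<partial>M) +
    (\<integral>\<^sup>+\<omega>. ennreal ((X (Suc n) \<omega>)\<^sup>2) * indicator A \<omega> \<partial>M)"
proof -
  have XM [measurable]: "X k \<in> borel_measurable M" if "k \<ge> 1" for k
    using indep that by (auto simp: indep_vars_def2)
  have [measurable]: "X (Suc n) \<in> borel_measurable M" by (rule XM) simp
  have SM [measurable]: "S \<in> borel_measurable M"
    by (rule borel_measurable_generated_by_imp[OF _ S(1)]) (auto intro: XM)
  have AM [measurable]: "A \<in> sets M"
    using A sets_generated_by_subset[of "{1..n}" X M] XM by auto
  have SA: "(\<lambda>\<omega>. S \<omega> * indicator A \<omega>) \<in> borel_measurable (generated_by M X {1..n})"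
    using S(1) A by measurable
  have ind: "indep_var borel (\<lambda>\<omega>. S \<omega> * indicator A \<omega>) borel (\<lambda>\<omega>. X (Suc n) \<omega>)"
    by (rule indep_var_generated_by[OF indep _ _ _ SA]) auto
  have iX: "integrable M (X (Suc n))"
    by (rule integrable_of_square[OF _ int]) auto
  have iSA: "integrable M (\<lambda>\<omega>. S \<omega> * indicator A \<omega>)"
    using integrable_real_mult_indicator[OF AM integrable_of_square[OF SM S(2)]] .
  have mixed: "expectation (\<lambda>\<omega>. S \<omega> * indicator A \<omega> * X (Suc n) \<omega>) = 0"
    using indep_var_lebesgue_integral[OF ind iSA iX] cent[of "Suc n"] by simp
  have imixed: "integrable M (\<lambda>\<omega>. S \<omega> * indicator A \<omega> * X (Suc n) \<omega>)"
    using indep_var_integrable[OF ind iSA iX] .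
  have i1: "integrable M (\<lambda>\<omega>. (S \<omega>)\<^sup>2 * indicator A \<omega>)"
    using integrable_real_mult_indicator[OF AM S(2)] .
  have i2: "integrable M (\<lambda>\<omega>. (X (Suc n) \<omega>)\<^sup>2 * indicator A \<omega>)"
    using integrable_real_mult_indicator[OF AM int[of "Suc n"]] by simp
  have eq: "(S \<omega> + X (Suc n) \<omega>)\<^sup>2 * indicator A \<omega> = (S \<omega>)\<^sup>2 * indicator A \<omega> +
      (X (Suc n) \<omega>)\<^sup>2 * indicator A \<omega> + 2 * (S \<omega> * indicator A \<omega> * X (Suc n) \<omega>)" for \<omega>
    by (simp add: power2_sum algebra_simps)
  have i3: "integrable M (\<lambda>\<omega>. (S \<omega> + X (Suc n) \<omega>)\<^sup>2 * indicator A \<omega>)"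
    unfolding eq using i1 i2 imixed by auto
  have "expectation (\<lambda>\<omega>. (S \<omega> + X (Suc n) \<omega>)\<^sup>2 * indicator A \<omega>) =
      expectation (\<lambda>\<omega>. (S \<omega>)\<^sup>2 * indicator A \<omega>) + expectation (\<lambda>\<omega>. (X (Suc n) \<omega>)\<^sup>2 * indicator A \<omega>)"
    unfolding eq using i1 i2 imixed mixed by simp
  moreover have nn: "(\<integral>\<^sup>+\<omega>. ennreal ((f \<omega>)\<^sup>2) * indicator A \<omega> \<partial>M) =
      ennreal (expectation (\<lambda>\<omega>. (f \<omega>)\<^sup>2 * indicator A \<omega>))"
    if "integrable M (\<lambda>\<omega>. (f \<omega>)\<^sup>2 * indicator A \<omega>)" for f :: "'a \<Rightarrow> real"
    using nn_integral_eq_integral[OF that]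
    by (auto simp: ennreal_mult ennreal_indicator)
  ultimately show ?thesis
    by (simp add: nn i1 i2 i3 ennreal_plus integral_nonneg_AE)
qed

text \<open>
  Kolmogorov's one-series theorem. The maximal inequality, applied to the squares of the sums that
  start after \<open>m\<close>, bounds the probability that some later partial sum moves away by \<open>c\<close> through the
  tail of the variance series; since the tails vanish, the partial sums are almost surely Cauchy.
\<close>

lemma (in prob_space) AE_convergent_sum_indep_centred:
  fixes X :: "nat \<Rightarrow> 'a \<Rightarrow> real"
  assumes indep: "indep_vars (\<lambda>_. borel) X {1..}"
    and int: "\<And>k. k \<ge> 1 \<Longrightarrow> integrable M (\<lambda>\<omega>. (X k \<omega>)\<^sup>2)"
    and cent: "\<And>k. k \<ge> 1 \<Longrightarrow> expectation (X k) = 0"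
    and var: "summable (\<lambda>k. expectation (\<lambda>\<omega>. (X (Suc k) \<omega>)\<^sup>2))"
  shows "AE \<omega> in M. summable (\<lambda>k. X (Suc k) \<omega>)"
proof -
  define v where "v k = expectation (\<lambda>\<omega>. (X (Suc k) \<omega>)\<^sup>2)" for k
  define S where "S m n \<omega> = (\<Sum>k<n. X (Suc (k + m)) \<omega>)" for m n \<omega>
  have v0: "v k \<ge> 0" for k by (simp add: v_def)
  have sv: "summable v" using var by (simp add: v_def[abs_def])
  have XM [measurable]: "X (Suc k) \<in> borel_measurable M" for k
    using indep by (auto simp: indep_vars_def2)
  have SF: "S m n \<in> borel_measurable (generated_by M X {1..m + n})" for m n
    unfolding S_def[abs_def]
    by (intro borel_measurable_sum borel_measurable_generated_by_component) auto
  have SM [measurable]: "S m n \<in> borel_measurable M" for m n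
    unfolding S_def[abs_def] by measurable
  have S_Suc: "S m (Suc n) \<omega> = S m n \<omega> + X (Suc (m + n)) \<omega>" for m n \<omega>
    by (simp add: S_def add.commute)
  have Sint: "integrable M (\<lambda>\<omega>. (S m n \<omega>)\<^sup>2)" for m n
  proof (induction n)
    case (Suc n)
    show ?case unfolding S_Suc
      by (intro integrable_square_add Suc int) auto
  qed (simp add: S_def)
  have step: "(\<integral>\<^sup>+\<omega>. ennreal ((S m n \<omega> + X (Suc (m + n)) \<omega>)\<^sup>2) * indicator A \<omega> \<partial>M) =
      (\<integral>\<^sup>+\<omega>. ennreal ((S m n \<omega>)\<^sup>2) * indicator A \<omega> \<partial>M) +
      (\<integral>\<^sup>+\<omega>. ennreal ((X (Suc (m + n)) \<omega>)\<^sup>2) * indicator A \<omega> \<partial>M)"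
    if "A \<in> sets (generated_by M X {1..m + n})" for A m n
    by (rule indep_centred_increment[OF indep int cent SF Sint that])
  have tail: "(\<integral>\<^sup>+\<omega>. ennreal ((S m n \<omega>)\<^sup>2) \<partial>M) \<le> ennreal (\<Sum>k. v (k + m))" for m n
  proof -
    have "(\<integral>\<^sup>+\<omega>. ennreal ((S m n \<omega>)\<^sup>2) \<partial>M) = ennreal (\<Sum>k<n. v (k + m))"
    proof (induction n)
      case (Suc n)
      have "(\<integral>\<^sup>+\<omega>. ennreal ((S m (Suc n) \<omega>)\<^sup>2) \<partial>M) =
          (\<integral>\<^sup>+\<omega>. ennreal ((S m n \<omega> + X (Suc (m + n)) \<omega>)\<^sup>2) * indicator (space M) \<omega> \<partial>M)"
        unfolding S_Suc by (intro nn_integral_cong) auto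
      also have "\<dots> = (\<integral>\<^sup>+\<omega>. ennreal ((S m n \<omega>)\<^sup>2) * indicator (space M) \<omega> \<partial>M) +
          (\<integral>\<^sup>+\<omega>. ennreal ((X (Suc (m + n)) \<omega>)\<^sup>2) * indicator (space M) \<omega> \<partial>M)"
        using sets.top[of "generated_by M X {1..m + n}"] by (intro step) simp
      also have "\<dots> = (\<integral>\<^sup>+\<omega>. ennreal ((S m n \<omega>)\<^sup>2) \<partial>M) +
          (\<integral>\<^sup>+\<omega>. ennreal ((X (Suc (m + n)) \<omega>)\<^sup>2) \<partial>M)"
        by (intro arg_cong2[where f="(+)"] nn_integral_cong) auto
      also have "(\<integral>\<^sup>+\<omega>. ennreal ((X (Suc (m + n)) \<omega>)\<^sup>2) \<partial>M) = ennreal (v (m + n))"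
        unfolding v_def by (intro nn_integral_eq_integral int) auto
      finally show ?case
        unfolding Suc by (simp add: v0 sum_nonneg ennreal_plus add.commute)
    qed (simp add: S_def)
    also have "\<dots> \<le> ennreal (\<Sum>k. v (k + m))"
      using sv v0 by (intro ennreal_leI sum_le_suminf) (auto simp: summable_iff_shift)
    finally show ?thesis .
  qed
  have max: "ennreal (c\<^sup>2) * emeasure M {\<omega>\<in>space M. \<exists>n. ennreal ((S m n \<omega>)\<^sup>2) \<ge> ennreal (c\<^sup>2)}
      \<le> ennreal (\<Sum>k. v (k + m))" for c m
  proof (rule maximal_inequality[where F = "\<lambda>n. generated_by M X {1..m + n}"])
    show "sets (generated_by M X {1..m + n}) \<subseteq> sets M" for n
      by (rule sets_generated_by_subset) (use indep in \<open>auto simp: indep_vars_def2\<close>)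
    show "sets (generated_by M X {1..m + j}) \<subseteq> sets (generated_by M X {1..m + n})" if "j \<le> n" for j n
      using that by (intro sets_generated_by_mono) auto
    show "(\<lambda>\<omega>. ennreal ((S m n \<omega>)\<^sup>2)) \<in> borel_measurable (generated_by M X {1..m + n})" for n
      using SF by measurable
    show "(\<integral>\<^sup>+\<omega>. ennreal ((S m n \<omega>)\<^sup>2) * indicator A \<omega> \<partial>M)
        \<le> (\<integral>\<^sup>+\<omega>. ennreal ((S m (Suc n) \<omega>)\<^sup>2) * indicator A \<omega> \<partial>M)"
      if "A \<in> sets (generated_by M X {1..m + n})" for n A
      unfolding S_Suc step[OF that] by simp
  qed (auto intro: tail)
  have lim0: "(\<lambda>m. \<Sum>k. v (k + m)) \<longlonglongrightarrow> 0"
    by (rule suminf_exist_split2[OF sv])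
  have AE1: "AE \<omega> in M. \<exists>m. \<forall>n. \<bar>S m n \<omega>\<bar> < c" if c: "c > 0" for c :: real
  proof -
    let ?N = "{\<omega>\<in>space M. \<forall>m. \<exists>n. \<bar>S m n \<omega>\<bar> \<ge> c}"
    have "c\<^sup>2 * prob ?N \<le> (\<Sum>k. v (k + m))" for m
    proof -
      have eq: "ennreal ((S m n \<omega>)\<^sup>2) \<ge> ennreal (c\<^sup>2) \<longleftrightarrow> \<bar>S m n \<omega>\<bar> \<ge> c" for n \<omega>
        using c by (simp add: ennreal_le_iff abs_le_square_iff[symmetric])
      have "prob ?N \<le> prob {\<omega>\<in>space M. \<exists>n. \<bar>S m n \<omega>\<bar> \<ge> c}"
        by (intro finite_measure_mono) auto
      then have "ennreal (c\<^sup>2 * prob ?N) \<le> ennreal (c\<^sup>2) * emeasure M {\<omega>\<in>space M. \<exists>n. \<bar>S m n \<omega>\<bar> \<ge> c}"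
        by (simp add: emeasure_eq_measure flip: ennreal_mult) (simp add: ennreal_leI mult_left_mono)
      also have "\<dots> \<le> ennreal (\<Sum>k. v (k + m))"
        using max[of c m] unfolding eq .
      finally show ?thesis
        using v0 sv by (simp add: ennreal_le_iff suminf_nonneg summable_iff_shift)
    qed
    then have "c\<^sup>2 * prob ?N \<le> 0"
      by (intro LIMSEQ_le_const[OF lim0]) auto
    then have "prob ?N = 0"
      using c by (simp add: mult_le_0_iff measure_le_0_iff)
    then have "emeasure M ?N = 0" by (simp add: emeasure_eq_measure)
    then show ?thesis
      by (intro AE_I[of _ _ ?N]) (auto simp: not_less)
  qed
  have "AE \<omega> in M. \<forall>j::nat. \<exists>m. \<forall>n. \<bar>S m n \<omega>\<bar> < inverse (Suc j)"
    unfolding AE_all_countable by (intro allI AE1) simp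
  then show ?thesis
  proof eventually_elim
    fix \<omega> assume *: "\<forall>j::nat. \<exists>m. \<forall>n. \<bar>S m n \<omega>\<bar> < inverse (Suc j)"
    show "summable (\<lambda>k. X (Suc k) \<omega>)"
      unfolding summable_iff_convergent
    proof (rule Cauchy_convergent, rule CauchyI)
      fix e :: real assume "e > 0"
      then obtain j :: nat where j: "inverse (Suc j) < e / 2"
        using reals_Archimedean[of "e/2"] by auto
      obtain m where m: "\<And>n. \<bar>S m n \<omega>\<bar> < inverse (Suc j)" using * by blast
      have S: "(\<Sum>k<n. X (Suc k) \<omega>) = (\<Sum>k<m. X (Suc k) \<omega>) + S m (n - m) \<omega>" if "n \<ge> m" for n
        using that sum.shift_bounds_nat_ivl[of "\<lambda>k. X (Suc k) \<omega>" 0 m "n - m"] sum.atLeastLessThan_concat[of 0 m n "\<lambda>k. X (Suc k) \<omega>"]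
        by (simp add: S_def atLeast0LessThan add.commute)
      show "\<exists>N. \<forall>a\<ge>N. \<forall>b\<ge>N. norm ((\<Sum>k<a. X (Suc k) \<omega>) - (\<Sum>k<b. X (Suc k) \<omega>)) < e"
      proof (intro exI allI impI)
        fix a b assume "a \<ge> m" "b \<ge> m"
        then show "norm ((\<Sum>k<a. X (Suc k) \<omega>) - (\<Sum>k<b. X (Suc k) \<omega>)) < e"
          unfolding real_norm_def using S[of a] S[of b] m[of "a - m"] m[of "b - m"] j by linarith
      qed
    qed
  qed
qed

section \<open>Products of independent positive factors\<close>

lemma filterlim_sum_at_top_of_not_summable:
  fixes f :: "nat \<Rightarrow> real"
  assumes "\<And>k. f k \<ge> 0" "\<not> summable f"
  shows "filterlim (\<lambda>n. \<Sum>k<n. f k) at_top sequentially"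
  unfolding filterlim_at_top
proof
  fix B :: real
  have "\<exists>n. (\<Sum>k<n. f k) > B"
    using assms summableI_nonneg_bounded[of f B] by (force simp: not_le)
  then obtain n where n: "(\<Sum>k<n. f k) > B" ..
  have "B \<le> (\<Sum>k<m. f k)" if "m \<ge> n" for m
    using sum_mono2[of "{..<m}" "{..<n}" f] that n assms(1) by auto
  then show "\<forall>\<^sub>F n in sequentially. B \<le> (\<Sum>k<n. f k)"
    by (auto simp: eventually_sequentially)
qed

text \<open>
  Since \<open>ln (1 + t) = t + O(t\<^sup>2)\<close>, convergence of both series makes the series of logarithms converge.
  Mere conditional convergence of the first series would not suffice.
\<close>

lemma prod_one_plus_tendsto_pos:
  fixes t :: "nat \<Rightarrow> real"
  assumes t: "\<And>k. t k > -1" and sum: "summable t" and sq: "summable (\<lambda>k. (t k)\<^sup>2)"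
  shows "\<exists>L>0. (\<lambda>n. \<Prod>k<n. 1 + t k) \<longlonglongrightarrow> L"
proof -
  have "\<forall>\<^sub>F k in sequentially. \<bar>t k\<bar> < 1/2"
    using order_tendstoD(2)[OF tendsto_rabs_zero[OF summable_LIMSEQ_zero[OF sum]], of "1/2"] by simp
  then have "\<forall>\<^sub>F k in sequentially. norm (ln (1 + t k) - t k) \<le> 2 * (t k)\<^sup>2"
    by eventually_elim (use abs_ln_one_plus_x_minus_x_bound in auto)
  then have "summable (\<lambda>k. ln (1 + t k) - t k)"
    by (rule summable_comparison_test_ev) (rule summable_mult[OF sq])
  from summable_add[OF this sum] have "summable (\<lambda>k. ln (1 + t k))" by simp
  then have "(\<lambda>n. exp (\<Sum>k<n. ln (1 + t k))) \<longlonglongrightarrow> exp (\<Sum>k. ln (1 + t k))"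
    by (intro tendsto_exp summable_LIMSEQ)
  moreover have "exp (\<Sum>k<n. ln (1 + t k)) = (\<Prod>k<n. 1 + t k)" for n
  proof -
    have "exp (ln (1 + t k)) = 1 + t k" for k
      using t[of k] by (intro exp_ln) linarith
    then show ?thesis by (simp add: exp_sum)
  qed
  ultimately show ?thesis by (intro exI[of _ "exp (\<Sum>k. ln (1 + t k))"]) simp
qed

lemma prod_sqrt_square:
  fixes z :: "nat \<Rightarrow> real"
  assumes "\<And>k. k \<ge> 1 \<Longrightarrow> z k > 0"
  shows "(\<Prod>k<n. sqrt (z (Suc k)))\<^sup>2 = (\<Prod>k=1..n. z k)"
  using assms
  by (simp add: prod.atLeast1_atMost_eq power2_eq_square less_imp_le flip: prod.distrib)

lemma (in prob_space) AE_summable_of_expectation: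
  fixes f :: "nat \<Rightarrow> 'a \<Rightarrow> real"
  assumes int: "\<And>k. integrable M (f k)" and nn: "\<And>k \<omega>. f k \<omega> \<ge> 0"
    and sum: "summable (\<lambda>k. expectation (f k))"
  shows "AE \<omega> in M. summable (\<lambda>k. f k \<omega>)"
proof -
  have [measurable]: "f k \<in> borel_measurable M" for k using int by auto
  have "(\<integral>\<^sup>+\<omega>. (\<Sum>k. ennreal (f k \<omega>)) \<partial>M) = (\<Sum>k. ennreal (expectation (f k)))"
    by (subst nn_integral_suminf) (auto simp: nn_integral_eq_integral int nn)
  also have "\<dots> = ennreal (\<Sum>k. expectation (f k))"
    by (rule suminf_ennreal2) (auto simp: nn sum)
  finally have "AE \<omega> in M. (\<Sum>k. ennreal (f k \<omega>)) \<noteq> \<infinity>"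
    by (intro nn_integral_PInf_AE) auto
  then show ?thesis
    by eventually_elim (rule summable_suminf_not_top, use nn in auto)
qed

lemma (in prob_space)
  fixes Z :: "'a \<Rightarrow> real"
  assumes pos: "\<And>\<omega>. Z \<omega> > 0" and int: "integrable M Z" and le: "expectation Z \<le> 1"
  shows integrable_sqrt: "integrable M (\<lambda>\<omega>. sqrt (Z \<omega>))"
    and expectation_sqrt_pos: "expectation (\<lambda>\<omega>. sqrt (Z \<omega>)) > 0"
    and expectation_sqrt_le_1: "expectation (\<lambda>\<omega>. sqrt (Z \<omega>)) \<le> 1"
proof -
  have [measurable]: "Z \<in> borel_measurable M" using int by auto
  have bound: "2 * sqrt (Z \<omega>) \<le> 1 + Z \<omega>" for \<omega>
    using sum_squares_bound[of 1 "sqrt (Z \<omega>)"] pos[of \<omega>] by simp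
  show 1: "integrable M (\<lambda>\<omega>. sqrt (Z \<omega>))"
  proof (rule Bochner_Integration.integrable_bound)
    show "integrable M (\<lambda>\<omega>. 1 + Z \<omega>)" using int by auto
    have "sqrt (Z \<omega>) \<le> 1 + Z \<omega>" for \<omega>
      using bound[of \<omega>] pos[of \<omega>] real_sqrt_ge_zero[of "Z \<omega>"] by linarith
    then show "AE \<omega> in M. norm (sqrt (Z \<omega>)) \<le> norm (1 + Z \<omega>)"
      using pos by (simp add: less_imp_le)
  qed measurable
  have "expectation (\<lambda>\<omega>. 2 * sqrt (Z \<omega>)) \<le> expectation (\<lambda>\<omega>. 1 + Z \<omega>)"
    using 1 int bound by (intro integral_mono) auto
  then show "expectation (\<lambda>\<omega>. sqrt (Z \<omega>)) \<le> 1"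
    using int le by (simp add: prob_space)
  have "expectation (\<lambda>\<omega>. sqrt (Z \<omega>)) \<noteq> 0"
  proof
    assume "expectation (\<lambda>\<omega>. sqrt (Z \<omega>)) = 0"
    then have "AE \<omega> in M. sqrt (Z \<omega>) = 0"
      using 1 pos by (subst (asm) integral_nonneg_eq_0_iff_AE) (auto simp: less_imp_le)
    then have "AE \<omega> in M. False"
      by eventually_elim (use pos in \<open>simp add: less_le\<close>)
    then show False by simp
  qed
  then show "expectation (\<lambda>\<omega>. sqrt (Z \<omega>)) > 0"
    using pos by (simp add: less_le less_imp_le integral_nonneg_AE)
qed

text \<open>
  Kakutani's dichotomy. A product of independent positive factors with expectations at most one
  converges almost surely, either to a positive limit or to zero, and which of the two happens is
  decided by the expectations \<open>a k\<close> of the square roots of the factors.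
\<close>

context prob_space
begin

context
  fixes Z :: "nat \<Rightarrow> 'a \<Rightarrow> real"
  assumes indep: "indep_vars (\<lambda>_. borel) Z {1..}"
    and pos: "\<And>k \<omega>. k \<ge> 1 \<Longrightarrow> Z k \<omega> > 0"
    and int: "\<And>k. k \<ge> 1 \<Longrightarrow> integrable M (Z k)"
    and le: "\<And>k. k \<ge> 1 \<Longrightarrow> expectation (Z k) \<le> 1"
begin

text \<open>
  Square roots turn the one-sided information on the factors into variances: both
  \<open>(sqrt (Z k) - a k)\<^sup>2\<close> and \<open>(sqrt (Z k) - 1)\<^sup>2\<close> have expectation at most \<open>2 * (1 - a k)\<close>. So
  \<open>sqrt (Z k) - 1\<close> is summable together with its square.
\<close>

lemma prod_indep_tendsto_pos:
  assumes sum: "summable (\<lambda>k. 1 - expectation (\<lambda>\<omega>. sqrt (Z (Suc k) \<omega>)))"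
  shows "AE \<omega> in M. \<exists>L>0. (\<lambda>n. \<Prod>k=1..n. Z k \<omega>) \<longlonglongrightarrow> L"
proof -
  define a where "a k = expectation (\<lambda>\<omega>. sqrt (Z k \<omega>))" for k
  have ZM [measurable]: "Z (Suc k) \<in> borel_measurable M" for k
    using int[of "Suc k"] by auto
  have sqi: "integrable M (\<lambda>\<omega>. sqrt (Z k \<omega>))" and a0: "a k > 0" and a1: "a k \<le> 1" if "k \<ge> 1" for k
    using integrable_sqrt[OF pos int le] expectation_sqrt_pos[OF pos int le]
      expectation_sqrt_le_1[OF pos int le] that by (auto simp: a_def)
  have sq: "(sqrt (Z k \<omega>) - c)\<^sup>2 = Z k \<omega> - 2 * c * sqrt (Z k \<omega>) + c\<^sup>2"
    if "k \<ge> 1" for k c \<omega>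
    using pos[OF that, of \<omega>] by (simp add: power2_diff less_imp_le)
  have i2: "integrable M (\<lambda>\<omega>. (sqrt (Z k \<omega>) - c)\<^sup>2)" if "k \<ge> 1" for k c
    unfolding sq[OF that] using sqi[OF that] int[OF that] by auto
  have E2: "expectation (\<lambda>\<omega>. (sqrt (Z k \<omega>) - c)\<^sup>2) \<le> 1 - 2 * c * a k + c\<^sup>2" if "k \<ge> 1" for k c
    unfolding sq[OF that] using sqi[OF that] int[OF that] le[OF that] by (simp add: a_def prob_space)
  have s2: "summable (\<lambda>k. 2 * (1 - a (Suc k)))"
    using sum by (intro summable_mult) (simp add: a_def)
  have "AE \<omega> in M. summable (\<lambda>k. sqrt (Z (Suc k) \<omega>) - a (Suc k))"
  proof (rule AE_convergent_sum_indep_centred)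
    show "indep_vars (\<lambda>_. borel) (\<lambda>k \<omega>. sqrt (Z k \<omega>) - a k) {1..}"
      by (rule indep_vars_compose2[OF indep]) measurable
    show "expectation (\<lambda>\<omega>. sqrt (Z k \<omega>) - a k) = 0" if "k \<ge> 1" for k
      using sqi[OF that] by (simp add: a_def prob_space)
    show "summable (\<lambda>k. expectation (\<lambda>\<omega>. (sqrt (Z (Suc k) \<omega>) - a (Suc k))\<^sup>2))"
    proof (rule summable_comparison_test'[OF s2])
      fix k :: nat
      have "1 - (a (Suc k))\<^sup>2 \<le> 2 * (1 - a (Suc k))"
        using sum_squares_bound[of "a (Suc k)" 1] by simp
      then show "norm (expectation (\<lambda>\<omega>. (sqrt (Z (Suc k) \<omega>) - a (Suc k))\<^sup>2)) \<le> 2 * (1 - a (Suc k))"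
        using E2[of "Suc k" "a (Suc k)"] by (simp add: power2_eq_square)
    qed
  qed (rule i2)
  moreover have "AE \<omega> in M. summable (\<lambda>k. (sqrt (Z (Suc k) \<omega>) - 1)\<^sup>2)"
  proof (rule AE_summable_of_expectation)
    show "summable (\<lambda>k. expectation (\<lambda>\<omega>. (sqrt (Z (Suc k) \<omega>) - 1)\<^sup>2))"
      by (rule summable_comparison_test'[OF s2]) (use E2[of "Suc _" 1] in simp)
  qed (auto intro: i2)
  ultimately show ?thesis
  proof eventually_elim
    case (elim \<omega>)
    have "summable (\<lambda>k. sqrt (Z (Suc k) \<omega>) - 1)"
      using summable_diff[OF elim(1) sum] by (simp add: a_def)
    then obtain L where L: "L > 0" "(\<lambda>n. \<Prod>k<n. 1 + (sqrt (Z (Suc k) \<omega>) - 1)) \<longlonglongrightarrow> L"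
      using prod_one_plus_tendsto_pos[OF _ _ elim(2)] pos by auto
    have "(\<lambda>n. (\<Prod>k<n. 1 + (sqrt (Z (Suc k) \<omega>) - 1))\<^sup>2) \<longlonglongrightarrow> L\<^sup>2"
      by (intro tendsto_power L)
    then show ?case
      using L(1) prod_sqrt_square[of "\<lambda>k. Z k \<omega>"] pos by (intro exI[of _ "L\<^sup>2"]) simp
  qed
qed

text \<open>
  The normalised factors \<open>sqrt (Z k) / a k\<close> have expectation one, so their products \<open>N n\<close> form a
  nonnegative martingale, which the maximal inequality keeps bounded along almost every path. The
  normalising constants, however, multiply to zero because \<open>a k \<le> exp (- (1 - a k))\<close>.
\<close>

lemma prod_indep_tendsto_zero:
  assumes nsum: "\<not> summable (\<lambda>k. 1 - expectation (\<lambda>\<omega>. sqrt (Z (Suc k) \<omega>)))"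
  shows "AE \<omega> in M. (\<lambda>n. \<Prod>k=1..n. Z k \<omega>) \<longlonglongrightarrow> 0"
proof -
  define a where "a k = expectation (\<lambda>\<omega>. sqrt (Z k \<omega>))" for k
  define N where "N n \<omega> = (\<Prod>k<n. sqrt (Z (Suc k) \<omega>) / a (Suc k))" for n \<omega>
  have sqi: "integrable M (\<lambda>\<omega>. sqrt (Z k \<omega>))" and a0: "a k > 0" and a1: "a k \<le> 1" if "k \<ge> 1" for k
    using integrable_sqrt[OF pos int le] expectation_sqrt_pos[OF pos int le]
      expectation_sqrt_le_1[OF pos int le] that by (auto simp: a_def)
  have N0: "N n \<omega> \<ge> 0" for n \<omega>
    unfolding N_def using a0 pos by (intro prod_nonneg) (auto simp: less_imp_le)
  have NF: "N n \<in> borel_measurable (generated_by M Z {1..n})" for n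
    unfolding N_def[abs_def]
  proof (rule borel_measurable_prod)
    fix k assume "k \<in> {..<n}"
    then have [measurable]: "Z (Suc k) \<in> borel_measurable (generated_by M Z {1..n})"
      by (intro borel_measurable_generated_by_component) auto
    show "(\<lambda>\<omega>. sqrt (Z (Suc k) \<omega>) / a (Suc k)) \<in> borel_measurable (generated_by M Z {1..n})"
      by measurable
  qed
  have ZM: "Z k \<in> borel_measurable M" if "k \<ge> 1" for k
    using int[OF that] by auto
  have NM [measurable]: "N n \<in> borel_measurable M" for n
    by (rule borel_measurable_generated_by_imp[OF _ NF]) (auto intro: ZM)
  have mart: "(\<integral>\<^sup>+\<omega>. ennreal (N (Suc n) \<omega>) * indicator A \<omega> \<partial>M) =
      (\<integral>\<^sup>+\<omega>. ennreal (N n \<omega>) * indicator A \<omega> \<partial>M)"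
    if A: "A \<in> sets (generated_by M Z {1..n})" for n A
  proof -
    let ?h = "\<lambda>z. ennreal (sqrt z / a (Suc n))"
    have GA: "(\<lambda>\<omega>. ennreal (N n \<omega>) * indicator A \<omega>) \<in> borel_measurable (generated_by M Z {1..n})"
      using NF A by measurable
    have ind: "indep_var borel (\<lambda>\<omega>. ennreal (N n \<omega>) * indicator A \<omega>) borel (\<lambda>\<omega>. ?h (Z (Suc n) \<omega>))"
      by (rule indep_var_generated_by[OF indep _ _ _ GA]) auto
    have "(\<integral>\<^sup>+\<omega>. ?h (Z (Suc n) \<omega>) \<partial>M) = ennreal (expectation (\<lambda>\<omega>. sqrt (Z (Suc n) \<omega>) / a (Suc n)))"
      using sqi[of "Suc n"] a0[of "Suc n"] pos
      by (intro nn_integral_eq_integral) (auto simp: less_imp_le)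
    also have "\<dots> = 1"
      using a0[of "Suc n"] by (simp add: a_def)
    finally have 1: "(\<integral>\<^sup>+\<omega>. ?h (Z (Suc n) \<omega>) \<partial>M) = 1" .
    have "(\<integral>\<^sup>+\<omega>. ennreal (N (Suc n) \<omega>) * indicator A \<omega> \<partial>M) =
        (\<integral>\<^sup>+\<omega>. (ennreal (N n \<omega>) * indicator A \<omega>) * ?h (Z (Suc n) \<omega>) \<partial>M)"
    proof (rule nn_integral_cong)
      fix \<omega>
      have "N (Suc n) \<omega> = N n \<omega> * (sqrt (Z (Suc n) \<omega>) / a (Suc n))"
        by (simp add: N_def)
      then have "ennreal (N (Suc n) \<omega>) = ennreal (N n \<omega>) * ?h (Z (Suc n) \<omega>)"
        by (simp only: ennreal_mult'[OF N0])
      then show "ennreal (N (Suc n) \<omega>) * indicator A \<omega> = ennreal (N n \<omega>) * indicator A \<omega> * ?h (Z (Suc n) \<omega>)"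
        by (simp add: mult_ac)
    qed
    also have "\<dots> = (\<integral>\<^sup>+\<omega>. ennreal (N n \<omega>) * indicator A \<omega> \<partial>M)"
      using indep_var_nn_integral_mult[OF ind] 1 by simp
    finally show ?thesis .
  qed
  have EN: "(\<integral>\<^sup>+\<omega>. ennreal (N n \<omega>) \<partial>M) \<le> 1" for n
  proof (induction n)
    case (Suc n)
    have "(\<integral>\<^sup>+\<omega>. ennreal (N (Suc n) \<omega>) \<partial>M) = (\<integral>\<^sup>+\<omega>. ennreal (N (Suc n) \<omega>) * indicator (space M) \<omega> \<partial>M)"
      by (intro nn_integral_cong) auto
    also have "\<dots> = (\<integral>\<^sup>+\<omega>. ennreal (N n \<omega>) * indicator (space M) \<omega> \<partial>M)"
      using sets.top[of "generated_by M Z {1..n}"] by (intro mart) simp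
    also have "\<dots> = (\<integral>\<^sup>+\<omega>. ennreal (N n \<omega>) \<partial>M)"
      by (intro nn_integral_cong) auto
    finally show ?case using Suc by simp
  qed (simp add: N_def emeasure_space_1)
  have max: "c * emeasure M {\<omega>\<in>space M. \<exists>n. ennreal (N n \<omega>) \<ge> c} \<le> 1" for c
  proof (rule maximal_inequality[where F = "\<lambda>n. generated_by M Z {1..n}"])
    show "sets (generated_by M Z {1..n}) \<subseteq> sets M" for n
      by (rule sets_generated_by_subset) (auto intro: ZM)
    show "(\<lambda>\<omega>. ennreal (N n \<omega>)) \<in> borel_measurable (generated_by M Z {1..n})" for n
      using NF by measurable
  qed (simp_all add: sets_generated_by_mono mart EN)
  let ?U = "{\<omega>\<in>space M. \<forall>c::nat. \<exists>n. ennreal (N n \<omega>) \<ge> of_nat c}"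
  have "of_nat c * emeasure M ?U \<le> 1" for c
  proof -
    have "emeasure M ?U \<le> emeasure M {\<omega>\<in>space M. \<exists>n. ennreal (N n \<omega>) \<ge> of_nat c}"
      by (intro emeasure_mono) auto
    then show ?thesis
      using max[of "of_nat c"] by (meson mult_left_mono order_trans zero_le)
  qed
  then have "real c * prob ?U \<le> 1" for c
    by (simp add: emeasure_eq_measure ennreal_of_nat_eq_real_of_nat flip: ennreal_mult)
  then have "prob ?U \<le> 0"
    using ex_less_of_nat_mult[of "prob ?U" 1] by (meson not_le)
  then have "emeasure M ?U = 0"
    by (simp add: emeasure_eq_measure measure_le_0_iff)
  then have "AE \<omega> in M. \<exists>c::nat. \<forall>n. \<not> of_nat c \<le> ennreal (N n \<omega>)"
    by (intro AE_I[of _ _ ?U]) auto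
  then show ?thesis
  proof eventually_elim
    case (elim \<omega>)
    then obtain c :: nat where "\<And>n. \<not> of_nat c \<le> ennreal (N n \<omega>)" by blast
    then have c: "N n \<omega> \<le> c" for n
      using ennreal_leI[of "real c" "N n \<omega>"] by (force simp: ennreal_of_nat_eq_real_of_nat)
    have "filterlim (\<lambda>n. \<Sum>k<n. 1 - a (Suc k)) at_top sequentially"
      using nsum a1 by (intro filterlim_sum_at_top_of_not_summable) (auto simp: a_def)
    then have "(\<lambda>n. exp (- (\<Sum>k<n. 1 - a (Suc k)))) \<longlonglongrightarrow> 0"
      by (intro filterlim_compose[OF exp_at_bot] filterlim_uminus_at_bot_at_top[THEN filterlim_compose])
    then have "(\<lambda>n. real c * exp (- (\<Sum>k<n. 1 - a (Suc k)))) \<longlonglongrightarrow> 0"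
      by (rule tendsto_mult_right_zero)
    then have lim: "(\<lambda>n. \<Prod>k<n. sqrt (Z (Suc k) \<omega>)) \<longlonglongrightarrow> 0"
    proof (rule Lim_null_comparison[rotated], intro always_eventually allI)
      fix n
      have "(\<Prod>k<n. a (Suc k)) \<le> (\<Prod>k<n. exp (- (1 - a (Suc k))))"
      proof (intro prod_mono conjI)
        show "a (Suc k) \<le> exp (- (1 - a (Suc k)))" for k
          using exp_ge_add_one_self[of "- (1 - a (Suc k))"] by simp
      qed (use a0 in \<open>simp add: less_imp_le\<close>)
      also have "\<dots> = exp (- (\<Sum>k<n. 1 - a (Suc k)))"
        by (simp add: exp_sum flip: sum_negf)
      finally have "N n \<omega> * (\<Prod>k<n. a (Suc k)) \<le> c * exp (- (\<Sum>k<n. 1 - a (Suc k)))"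
        using c N0 a0 by (intro mult_mono) (auto intro!: prod_nonneg simp: less_imp_le)
      moreover have "N n \<omega> * (\<Prod>k<n. a (Suc k)) = (\<Prod>k<n. sqrt (Z (Suc k) \<omega>))"
        using a0[of "Suc k" for k] by (simp add: N_def less_le flip: prod.distrib)
      ultimately show "norm (\<Prod>k<n. sqrt (Z (Suc k) \<omega>)) \<le> c * exp (- (\<Sum>k<n. 1 - a (Suc k)))"
        using pos by (simp add: prod_nonneg less_imp_le)
    qed
    have "(\<lambda>n. (\<Prod>k<n. sqrt (Z (Suc k) \<omega>))\<^sup>2) \<longlonglongrightarrow> 0\<^sup>2"
      by (intro tendsto_power lim)
    then show ?case using prod_sqrt_square[of "\<lambda>k. Z k \<omega>"] pos by simp
  qed
qed

end

end

section \<open>The log-normal return and its log-optimal fraction\<close>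

lemma (in prob_space)
  assumes "distributed M lborel X std_normal_density"
  shows integrable_exp_std_normal: "integrable M (\<lambda>\<omega>. exp (s * X \<omega>))"
    and expectation_exp_std_normal: "expectation (\<lambda>\<omega>. exp (s * X \<omega>)) = exp (s\<^sup>2 / 2)"
proof -
  \<comment> \<open>Completing the square shifts the mean from \<open>0\<close> to \<open>s\<close>.\<close>
  have *: "std_normal_density x * exp (s * x) = exp (s\<^sup>2 / 2) * normal_density s 1 x" for x
    by (simp add: normal_density_def std_normal_density_def power2_diff field_simps
        flip: exp_add exp_minus)
  have "integrable lborel (\<lambda>x. std_normal_density x * exp (s * x))"
    unfolding * by simp
  then show "integrable M (\<lambda>\<omega>. exp (s * X \<omega>))"
    by (subst (asm) distributed_integrable[OF assms]) auto
  have "expectation (\<lambda>\<omega>. exp (s * X \<omega>)) = (\<integral>x. std_normal_density x * exp (s * x) \<partial>lborel)"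
    by (rule distributed_integral[OF assms, symmetric]) auto
  then show "expectation (\<lambda>\<omega>. exp (s * X \<omega>)) = exp (s\<^sup>2 / 2)"
    unfolding * by simp
qed

lemma (in prob_space)
  assumes "distributed M lborel X std_normal_density"
  shows integrable_std_normal: "integrable M X"
    and expectation_std_normal: "expectation X = 0"
proof -
  show "integrable M X"
    by (rule distributed_integrable_var[OF assms]) (use integrable_std_normal_moment[of 1] in auto)
  show "expectation X = 0"
    using standard_normal_distributed_expectation[OF assms] .
qed

lemma ln_one_plus_lower_bound:
  fixes x :: real
  assumes "x \<ge> - (1/2)"
  shows "x - 2 * x\<^sup>2 \<le> ln (1 + x)"
proof -
  consider "x \<le> 0" | "0 \<le> x" "x \<le> 1" | "x > 1" by linarith
  then show ?thesis
  proof cases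
    case 1
    then show ?thesis using ln_one_minus_pos_lower_bound[of "- x"] assms by simp
  next
    case 2
    then show ?thesis using ln_one_plus_pos_lower_bound[of x] zero_le_power2[of x] by linarith
  next
    case 3
    then have "x * 1 \<le> x * x" by (intro mult_left_mono) auto
    then have "x - 2 * x\<^sup>2 \<le> 0" using 3 by (simp add: power2_eq_square)
    also have "0 \<le> ln (1 + x)" using 3 by (intro ln_ge_zero) auto
    finally show ?thesis .
  qed
qed

lemma one_plus_mult_pos:
  fixes d r :: real
  assumes "0 \<le> d" "d \<le> 1" "r > -1"
  shows "1 + d * r > 0"
proof -
  have "(1 - d) + d * (1 + r) > 0"
  proof (cases "d = 1")
    case False
    then show ?thesis using assms by (intro add_pos_nonneg) auto
  qed (use assms in auto)
  then show ?thesis by (simp add: algebra_simps)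
qed

text \<open>
  The wealth factor \<open>1 + d * r\<close> lies between \<open>1\<close> and \<open>1 + r\<close>. This dominates its inverse and its
  logarithm uniformly in the fraction \<open>d\<close>.
\<close>

lemma inverse_one_plus_mult_le:
  fixes d r :: real
  assumes "0 \<le> d" "d \<le> 1" "r > -1"
  shows "1 / (1 + d * r) \<le> 1 + 1 / (1 + r)"
proof -
  have "min 1 (1 + r) \<le> 1 + d * r"
    using assms mult_right_mono[of d 1 r] mult_right_mono_neg[of d 1 r]
    by (cases "r \<ge> 0") (auto simp: min_def)
  then have "1 / (1 + d * r) \<le> 1 / min 1 (1 + r)"
    using assms by (intro divide_left_mono mult_pos_pos one_plus_mult_pos) auto
  also have "\<dots> \<le> 1 + 1 / (1 + r)"
    using assms by (simp add: min_def)
  finally show ?thesis .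
qed

lemma abs_ln_one_plus_mult_le:
  fixes d r :: real
  assumes "0 \<le> d" "d \<le> 1" "r > -1"
  shows "\<bar>ln (1 + d * r)\<bar> \<le> \<bar>ln (1 + r)\<bar>"
proof (cases "r \<ge> 0")
  case True
  then have "d * r \<le> 1 * r" "0 \<le> d * r"
    using assms mult_right_mono[of d 1 r] by auto
  then show ?thesis using True by simp
next
  case False
  then have "1 * r \<le> d * r" "d * r \<le> 0"
    using assms mult_right_mono_neg[of d 1 r] by (auto simp: mult_nonneg_nonpos)
  then have "ln (1 + r) \<le> ln (1 + d * r)" "ln (1 + d * r) \<le> 0"
    using assms one_plus_mult_pos[OF assms] by (auto simp: ln_le_zero_iff)
  then show ?thesis by simp
qed

locale lognormal_market = prob_space M for M :: "'a measure" +
  fixes \<xi> :: "nat \<Rightarrow> 'a \<Rightarrow> real" and \<mu> \<sigma> :: "nat \<Rightarrow> real"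
  assumes indep: "indep_vars (\<lambda>_. borel) \<xi> {1..}"
    and normal: "\<And>k. k \<ge> 1 \<Longrightarrow> distributed M lborel (\<xi> k) std_normal_density"
    and \<sigma>_pos: "\<And>k. k \<ge> 1 \<Longrightarrow> \<sigma> k > 0"
begin

abbreviation R :: "nat \<Rightarrow> 'a \<Rightarrow> real" where "R \<equiv> simple_return \<mu> \<sigma> \<xi>"

abbreviation opt :: "nat \<Rightarrow> real" where "opt \<equiv> opt_fraction M \<mu> \<sigma> \<xi>"

lemma R_gt: "R k \<omega> > -1"
  by (simp add: simple_return_def)

lemma wealth_factor_pos: "0 \<le> d \<Longrightarrow> d \<le> 1 \<Longrightarrow> 1 + d * R k \<omega> > 0"
  by (rule one_plus_mult_pos) (auto simp: R_gt)

lemma xi_measurable [measurable]: "k \<ge> 1 \<Longrightarrow> \<xi> k \<in> borel_measurable M"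
  using indep by (auto simp: indep_vars_def2)

lemma R_measurable [measurable]: "k \<ge> 1 \<Longrightarrow> R k \<in> borel_measurable M"
  unfolding simple_return_def[abs_def] by measurable

lemma
  assumes "k \<ge> 1"
  shows integrable_powr: "integrable M (\<lambda>\<omega>. (1 + R k \<omega>) powr s)"
    and expectation_powr:
      "expectation (\<lambda>\<omega>. (1 + R k \<omega>) powr s) = exp (s * \<mu> k + s * (s - 1) * (\<sigma> k)\<^sup>2 / 2)"
proof -
  have *: "(1 + R k \<omega>) powr s = exp (s * (\<mu> k - (\<sigma> k)\<^sup>2 / 2)) * exp ((s * \<sigma> k) * \<xi> k \<omega>)" for \<omega>
    by (simp add: simple_return_def powr_def algebra_simps flip: exp_add)
  show "integrable M (\<lambda>\<omega>. (1 + R k \<omega>) powr s)"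
    unfolding * using integrable_exp_std_normal[OF normal[OF assms]] by simp
  show "expectation (\<lambda>\<omega>. (1 + R k \<omega>) powr s) = exp (s * \<mu> k + s * (s - 1) * (\<sigma> k)\<^sup>2 / 2)"
    unfolding * using expectation_exp_std_normal[OF normal[OF assms], of "s * \<sigma> k"]
    by simp (simp add: power_mult_distrib field_simps power2_eq_square flip: exp_add)
qed

lemma
  assumes "k \<ge> 1"
  shows integrable_R: "integrable M (R k)"
    and expectation_R: "expectation (R k) = exp (\<mu> k) - 1"
    and integrable_R_square: "integrable M (\<lambda>\<omega>. (R k \<omega>)\<^sup>2)"
    and expectation_R_square:
      "expectation (\<lambda>\<omega>. (R k \<omega>)\<^sup>2) = (exp (\<mu> k) - 1)\<^sup>2 + exp (2 * \<mu> k) * (exp ((\<sigma> k)\<^sup>2) - 1)"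
    and integrable_inverse_R: "integrable M (\<lambda>\<omega>. 1 / (1 + R k \<omega>))"
proof -
  have gt: "0 < 1 + R k \<omega>" for \<omega> using R_gt[of k \<omega>] by simp
  have i1: "integrable M (\<lambda>\<omega>. 1 + R k \<omega>)" and e1: "expectation (\<lambda>\<omega>. 1 + R k \<omega>) = exp (\<mu> k)"
    using integrable_powr[OF assms, of 1] expectation_powr[OF assms, of 1] gt
    by (simp_all add: powr_one' less_imp_le)
  have eq: "R k = (\<lambda>\<omega>. (1 + R k \<omega>) - 1)" by auto
  show iR: "integrable M (R k)"
    by (subst eq) (rule Bochner_Integration.integrable_diff[OF i1], simp)
  show eR: "expectation (R k) = exp (\<mu> k) - 1"
    by (subst eq) (subst Bochner_Integration.integral_diff[OF i1], auto simp: e1 prob_space)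
  have p2: "(1 + R k \<omega>) powr 2 = (1 + R k \<omega>)\<^sup>2" for \<omega>
    using gt[of \<omega>] by (simp add: powr_numeral)
  have i2: "integrable M (\<lambda>\<omega>. (1 + R k \<omega>)\<^sup>2)"
    and e2: "expectation (\<lambda>\<omega>. (1 + R k \<omega>)\<^sup>2) = exp (2 * \<mu> k + (\<sigma> k)\<^sup>2)"
    using integrable_powr[OF assms, of 2] expectation_powr[OF assms, of 2] by (simp_all add: p2)
  have eq2: "(\<lambda>\<omega>. (R k \<omega>)\<^sup>2) = (\<lambda>\<omega>. (1 + R k \<omega>)\<^sup>2 - (1 + 2 * R k \<omega>))"
    by (auto simp: power2_eq_square algebra_simps)
  show "integrable M (\<lambda>\<omega>. (R k \<omega>)\<^sup>2)"
    unfolding eq2 using i2 iR by auto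
  show "expectation (\<lambda>\<omega>. (R k \<omega>)\<^sup>2) = (exp (\<mu> k) - 1)\<^sup>2 + exp (2 * \<mu> k) * (exp ((\<sigma> k)\<^sup>2) - 1)"
    unfolding eq2 using i2 iR e2 eR
    by (simp add: prob_space exp_add exp_double) (simp add: power2_eq_square algebra_simps)
  have "(1 + R k \<omega>) powr (-1) = 1 / (1 + R k \<omega>)" for \<omega>
    using gt[of \<omega>] by (simp add: powr_minus powr_one' field_simps)
  then show "integrable M (\<lambda>\<omega>. 1 / (1 + R k \<omega>))"
    using integrable_powr[OF assms, of "-1"] by simp
qed

lemma ln_one_plus_R: "ln (1 + R k \<omega>) = \<mu> k - (\<sigma> k)\<^sup>2 / 2 + \<sigma> k * \<xi> k \<omega>"
  by (simp add: simple_return_def)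

lemma integrable_ln_factor:
  assumes "k \<ge> 1" "0 \<le> d" "d \<le> 1"
  shows "integrable M (\<lambda>\<omega>. ln (1 + d * R k \<omega>))"
proof (rule Bochner_Integration.integrable_bound)
  show "integrable M (\<lambda>\<omega>. ln (1 + R k \<omega>))"
    unfolding ln_one_plus_R using integrable_std_normal[OF normal[OF assms(1)]] by simp
  show "AE \<omega> in M. norm (ln (1 + d * R k \<omega>)) \<le> norm (ln (1 + R k \<omega>))"
    using abs_ln_one_plus_mult_le[OF assms(2,3)] R_gt by simp
qed (use assms in measurable)

lemma continuous_on_log_growth:
  assumes "k \<ge> 1"
  shows "continuous_on {0..1} (\<lambda>d. expectation (\<lambda>\<omega>. ln (1 + d * R k \<omega>)))"
  unfolding continuous_on_sequentially
proof (intro allI ballI impI, elim conjE)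
  fix u :: "nat \<Rightarrow> real" and d assume d: "d \<in> {0..1}" and u: "\<forall>n. u n \<in> {0..1}" "u \<longlonglongrightarrow> d"
  have "(\<lambda>n. expectation (\<lambda>\<omega>. ln (1 + u n * R k \<omega>))) \<longlonglongrightarrow> expectation (\<lambda>\<omega>. ln (1 + d * R k \<omega>))"
  proof (rule integral_dominated_convergence[where w = "\<lambda>\<omega>. \<bar>ln (1 + 1 * R k \<omega>)\<bar>"])
    show "integrable M (\<lambda>\<omega>. \<bar>ln (1 + 1 * R k \<omega>)\<bar>)"
      using integrable_ln_factor[OF assms, of 1] by (intro integrable_abs) auto
    show "AE \<omega> in M. norm (ln (1 + u n * R k \<omega>)) \<le> \<bar>ln (1 + 1 * R k \<omega>)\<bar>" for n
      using abs_ln_one_plus_mult_le[of "u n"] u(1) R_gt by simp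
    show "AE \<omega> in M. (\<lambda>n. ln (1 + u n * R k \<omega>)) \<longlonglongrightarrow> ln (1 + d * R k \<omega>)"
    proof (rule AE_I2)
      fix \<omega>
      show "(\<lambda>n. ln (1 + u n * R k \<omega>)) \<longlonglongrightarrow> ln (1 + d * R k \<omega>)"
        using wealth_factor_pos[of d k \<omega>] d by (intro tendsto_intros u) auto
    qed
  qed (use assms in measurable)
  then show "((\<lambda>d. expectation (\<lambda>\<omega>. ln (1 + d * R k \<omega>))) \<circ> u) \<longlonglongrightarrow> expectation (\<lambda>\<omega>. ln (1 + d * R k \<omega>))"
    by (simp add: o_def)
qed

text \<open>The maximum is attained because expected log-growth is continuous on the compact unit interval.\<close>

lemma
  assumes "k \<ge> 1"
  shows opt_nonneg: "0 \<le> opt k" and opt_le_1: "opt k \<le> 1"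
    and opt_maximal: "0 \<le> d \<Longrightarrow> d \<le> 1 \<Longrightarrow>
      expectation (\<lambda>\<omega>. ln (1 + d * R k \<omega>)) \<le> expectation (\<lambda>\<omega>. ln (1 + opt k * R k \<omega>))"
proof -
  let ?f = "\<lambda>d. expectation (\<lambda>\<omega>. ln (1 + d * R k \<omega>))"
  obtain m where "m \<in> {0..1}" "\<And>d. d \<in> {0..1} \<Longrightarrow> ?f d \<le> ?f m"
    using continuous_attains_sup[OF _ _ continuous_on_log_growth[OF assms]] by auto
  then have "is_arg_max ?f (\<lambda>d. 0 \<le> d \<and> d \<le> 1) m"
    by (auto simp: is_arg_max_def not_less)
  then have *: "is_arg_max ?f (\<lambda>d. 0 \<le> d \<and> d \<le> 1) (opt k)"
    unfolding opt_fraction_def arg_max_def by (rule someI)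
  then show "0 \<le> opt k" "opt k \<le> 1"
    "0 \<le> d \<Longrightarrow> d \<le> 1 \<Longrightarrow> ?f d \<le> ?f (opt k)"
    by (auto simp: is_arg_max_def not_less)
qed

lemma opt_factor_pos: "k \<ge> 1 \<Longrightarrow> 1 + opt k * R k \<omega> > 0"
  by (intro wealth_factor_pos opt_nonneg opt_le_1)

text \<open>
  The first-order condition for the maximum. With \<open>Q\<close> the relative excess of the fraction \<open>c\<close> over the
  optimal one, moving from \<open>opt k\<close> a step \<open>t\<close> towards \<open>c\<close> multiplies wealth by \<open>1 + t * Q\<close>. The
  expected logarithm of this factor is at most zero by maximality and at least
  \<open>t * E Q - 2 * t\<^sup>2 * E (Q\<^sup>2)\<close>; dividing by \<open>t\<close> and letting \<open>t\<close> tend to zero gives \<open>E Q \<le> 0\<close>.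
\<close>

lemma
  assumes k: "k \<ge> 1" and c: "0 \<le> c" "c \<le> 1"
  shows integrable_ratio: "integrable M (\<lambda>\<omega>. (1 + c * R k \<omega>) / (1 + opt k * R k \<omega>))"
    and expectation_ratio_le_1: "expectation (\<lambda>\<omega>. (1 + c * R k \<omega>) / (1 + opt k * R k \<omega>)) \<le> 1"
proof -
  define Q where "Q \<omega> = (1 + c * R k \<omega>) / (1 + opt k * R k \<omega>) - 1" for \<omega>
  define L where "L \<omega> = 1 + R k \<omega>" for \<omega>
  have Lpos: "L \<omega> > 0" for \<omega> using R_gt[of k \<omega>] by (simp add: L_def)
  have ipw: "integrable M (\<lambda>\<omega>. L \<omega> powr s)" for s
    using integrable_powr[OF k] by (simp add: L_def)
  have [measurable]: "R k \<in> borel_measurable M" "Q \<in> borel_measurable M"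
    unfolding Q_def[abs_def] using k by measurable
  have num: "0 < 1 + c * R k \<omega>" for \<omega> using c by (rule wealth_factor_pos)
  note den = opt_factor_pos[OF k]
  have Q1: "Q \<omega> > -1" for \<omega>
    using num[of \<omega>] den[of \<omega>] by (simp add: Q_def)
  have Q2: "\<bar>Q \<omega>\<bar> \<le> 3 + L \<omega> + 1 / L \<omega>" for \<omega>
  proof -
    have "c * R k \<omega> \<le> 1 + R k \<omega>"
      using c R_gt[of k \<omega>] mult_right_mono[of c 1 "1 + R k \<omega>"] by (simp add: algebra_simps)
    then have "(1 + c * R k \<omega>) * (1 / (1 + opt k * R k \<omega>)) \<le> (1 + L \<omega>) * (1 + 1 / L \<omega>)"
      unfolding L_def using inverse_one_plus_mult_le[OF opt_nonneg[OF k] opt_le_1[OF k] R_gt] num[of \<omega>] den[of \<omega>]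
        R_gt[of k \<omega>]
      by (intro mult_mono) auto
    also have "\<dots> = 2 + L \<omega> + 1 / L \<omega>"
      using Lpos[of \<omega>] by (simp add: field_simps)
    finally show ?thesis using Q1[of \<omega>] Lpos[of \<omega>] by (simp add: Q_def abs_le_iff add.commute) 
  qed
  have iQ2: "integrable M (\<lambda>\<omega>. (Q \<omega>)\<^sup>2)"
  proof (rule Bochner_Integration.integrable_bound)
    show "integrable M (\<lambda>\<omega>. 11 + L \<omega> powr 2 + L \<omega> powr (-2) + 6 * L \<omega> powr 1 + 6 * L \<omega> powr (-1))"
      by (intro Bochner_Integration.integrable_add integrable_mult_right ipw) auto
    show "AE \<omega> in M. norm ((Q \<omega>)\<^sup>2) \<le>
        norm (11 + L \<omega> powr 2 + L \<omega> powr (-2) + 6 * L \<omega> powr 1 + 6 * L \<omega> powr (-1))"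
    proof (rule AE_I2)
      fix \<omega>
      have "(Q \<omega>)\<^sup>2 \<le> (3 + L \<omega> + 1 / L \<omega>)\<^sup>2"
        using Q2[of \<omega>] by (simp add: abs_le_square_iff[symmetric])
      also have "\<dots> = 11 + L \<omega> powr 2 + L \<omega> powr (-2) + 6 * L \<omega> powr 1 + 6 * L \<omega> powr (-1)"
        using Lpos[of \<omega>] by (simp add: powr_minus powr_numeral power2_eq_square field_simps)
      finally show "norm ((Q \<omega>)\<^sup>2) \<le>
          norm (11 + L \<omega> powr 2 + L \<omega> powr (-2) + 6 * L \<omega> powr 1 + 6 * L \<omega> powr (-1))"
        by simp
    qed
  qed simp
  have iQ: "integrable M Q"
    by (rule integrable_of_square[OF _ iQ2]) simp
  have slope: "expectation Q \<le> t * (2 * expectation (\<lambda>\<omega>. (Q \<omega>)\<^sup>2))" if t: "0 < t" "t \<le> 1/2" for t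
  proof -
    define d where "d = (1 - t) * opt k + t * c"
    have d: "0 \<le> d" "d \<le> 1"
      using t c opt_nonneg[OF k] opt_le_1[OF k] convex_bound_le[of "opt k" 1 c "1 - t" t]
      by (auto simp: d_def)
    have fac: "ln (1 + d * R k \<omega>) = ln (1 + opt k * R k \<omega>) + ln (1 + t * Q \<omega>)" for \<omega>
    proof -
      have "1 + d * R k \<omega> = (1 + opt k * R k \<omega>) * (1 + t * Q \<omega>)"
        using den[of \<omega>] by (simp add: d_def Q_def divide_simps) (simp add: algebra_simps)
      moreover have "1 + t * Q \<omega> > 0"
        using t Q1[of \<omega>] by (intro one_plus_mult_pos) auto
      ultimately show ?thesis
        using den[of \<omega>] by (simp add: ln_mult)
    qed
    have "expectation (\<lambda>\<omega>. t * Q \<omega> - 2 * (t * Q \<omega>)\<^sup>2) \<le>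
        expectation (\<lambda>\<omega>. ln (1 + d * R k \<omega>) - ln (1 + opt k * R k \<omega>))"
    proof (rule integral_mono)
      show "integrable M (\<lambda>\<omega>. t * Q \<omega> - 2 * (t * Q \<omega>)\<^sup>2)"
        using iQ iQ2 by (auto simp: power_mult_distrib)
      show "integrable M (\<lambda>\<omega>. ln (1 + d * R k \<omega>) - ln (1 + opt k * R k \<omega>))"
        using integrable_ln_factor[OF k] d opt_nonneg[OF k] opt_le_1[OF k] by auto
      fix \<omega>
      have "t * Q \<omega> \<ge> t * (-1)" using Q1[of \<omega>] t by (intro mult_left_mono) auto
      then have "t * Q \<omega> \<ge> - (1/2)" using t by linarith
      then show "t * Q \<omega> - 2 * (t * Q \<omega>)\<^sup>2 \<le> ln (1 + d * R k \<omega>) - ln (1 + opt k * R k \<omega>)"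
        using ln_one_plus_lower_bound[of "t * Q \<omega>"] fac[of \<omega>] by linarith
    qed
    also have "\<dots> \<le> 0"
      using opt_maximal[OF k d] integrable_ln_factor[OF k] d opt_nonneg[OF k] opt_le_1[OF k] by simp
    finally have "expectation (\<lambda>\<omega>. t * Q \<omega> - (2 * t\<^sup>2) * (Q \<omega>)\<^sup>2) \<le> 0"
      by (simp add: power_mult_distrib mult.assoc)
    then have "t * expectation Q - (2 * t\<^sup>2) * expectation (\<lambda>\<omega>. (Q \<omega>)\<^sup>2) \<le> 0"
      using iQ iQ2 by simp
    then have "t * expectation Q \<le> t * (t * (2 * expectation (\<lambda>\<omega>. (Q \<omega>)\<^sup>2)))"
      by (simp add: power2_eq_square mult_ac)
    then show ?thesis using t by simp
  qed
  have "((\<lambda>t. t * (2 * expectation (\<lambda>\<omega>. (Q \<omega>)\<^sup>2))) \<longlongrightarrow> 0 * (2 * expectation (\<lambda>\<omega>. (Q \<omega>)\<^sup>2))) (at_right 0)"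
    by (intro tendsto_intros)
  moreover have "\<forall>\<^sub>F t in at_right 0. expectation Q \<le> t * (2 * expectation (\<lambda>\<omega>. (Q \<omega>)\<^sup>2))"
    using slope by (auto simp: eventually_at_right_field intro!: exI[of _ "1/2"])
  ultimately have "expectation Q \<le> 0 * (2 * expectation (\<lambda>\<omega>. (Q \<omega>)\<^sup>2))"
    by (intro tendsto_lowerbound) auto
  moreover have eq: "(\<lambda>\<omega>. (1 + c * R k \<omega>) / (1 + opt k * R k \<omega>)) = (\<lambda>\<omega>. Q \<omega> + 1)"
    by (simp add: Q_def)
  ultimately show "expectation (\<lambda>\<omega>. (1 + c * R k \<omega>) / (1 + opt k * R k \<omega>)) \<le> 1"
    unfolding eq using iQ by (simp add: prob_space)
  show "integrable M (\<lambda>\<omega>. (1 + c * R k \<omega>) / (1 + opt k * R k \<omega>))"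
    unfolding eq using iQ by simp
qed

end

section \<open>The value of the log-optimal portfolio and asymptotic arbitrage\<close>

context lognormal_market
begin

abbreviation V :: "nat \<Rightarrow> 'a \<Rightarrow> real" where "V \<equiv> opt_value M \<mu> \<sigma> \<xi>"

lemma V_pos: "V n \<omega> > 0"
  unfolding opt_value_def by (intro prod_pos) (auto intro: opt_factor_pos)

lemma V_Suc: "V (Suc n) \<omega> = V n \<omega> * (1 + opt (Suc n) * R (Suc n) \<omega>)"
  by (simp add: opt_value_def)

lemma R_measurable_past:
  assumes "k \<in> I"
  shows "R k \<in> borel_measurable (generated_by M \<xi> I)"
proof -
  have [measurable]: "\<xi> k \<in> borel_measurable (generated_by M \<xi> I)"
    using assms by (rule borel_measurable_generated_by_component)
  show ?thesis unfolding simple_return_def[abs_def] by measurable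
qed

lemma V_measurable_past: "V n \<in> borel_measurable (generated_by M \<xi> {1..n})"
  unfolding opt_value_def[abs_def]
proof (rule borel_measurable_prod)
  fix k assume "k \<in> {1..n}"
  then have [measurable]: "R k \<in> borel_measurable (generated_by M \<xi> {1..n})"
    by (rule R_measurable_past)
  show "(\<lambda>\<omega>. 1 + opt k * R k \<omega>) \<in> borel_measurable (generated_by M \<xi> {1..n})"
    by measurable
qed

lemma measurable_past_imp: "G \<in> borel_measurable (generated_by M \<xi> {1..n}) \<Longrightarrow> G \<in> borel_measurable M"
  by (rule borel_measurable_generated_by_imp) auto

lemma V_measurable [measurable]: "V n \<in> borel_measurable M"
  by (rule measurable_past_imp[OF V_measurable_past])

text \<open>
  The log-optimal portfolio is a numeraire: measured in units of \<open>V\<close>, every value process is a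
  supermartingale. The relative one-step factor is an affine function of the invested fraction, so
  the bounds for the two extreme fractions \<open>0\<close> and \<open>1\<close>, taken separately, also cover a fraction that
  depends on the past.
\<close>

lemma
  assumes X: "X \<in> value_processes M \<mu> \<sigma> \<xi> n x" and n: "n \<ge> 1"
  shows value_process_measurable: "X n \<in> borel_measurable M"
    and integrable_relative_value: "integrable M (\<lambda>\<omega>. X n \<omega> / V n \<omega>)"
    and expectation_relative_value: "expectation (\<lambda>\<omega>. X n \<omega> / V n \<omega>) \<le> x"
    and value_process_initial_nonneg: "x \<ge> 0"
proof -
  have X0: "\<And>\<omega>. \<omega> \<in> space M \<Longrightarrow> X 0 \<omega> = x"
    using X by (simp add: value_processes_def)
  from X obtain \<delta> where "\<forall>k\<in>{1..n}. \<delta> k \<in> borel_measurable (generated_by M \<xi> {1..k - 1}) \<and>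
      (\<forall>\<omega>\<in>space M. \<delta> k \<omega> \<in> {0..1} \<and> X k \<omega> = X (k - 1) \<omega> * (1 + \<delta> k \<omega> * R k \<omega>) \<and> X k \<omega> \<ge> 0)"
    unfolding value_processes_def mem_Collect_eq by (elim conjE exE)
  then have \<delta>: "\<And>k. k \<in> {1..n} \<Longrightarrow> \<delta> k \<in> borel_measurable (generated_by M \<xi> {1..k - 1})"
    and \<delta>01: "\<And>k \<omega>. k \<in> {1..n} \<Longrightarrow> \<omega> \<in> space M \<Longrightarrow> 0 \<le> \<delta> k \<omega> \<and> \<delta> k \<omega> \<le> 1"
    and rec: "\<And>k \<omega>. k \<in> {1..n} \<Longrightarrow> \<omega> \<in> space M \<Longrightarrow> X k \<omega> = X (k - 1) \<omega> * (1 + \<delta> k \<omega> * R k \<omega>)"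
    and nn: "\<And>k \<omega>. k \<in> {1..n} \<Longrightarrow> \<omega> \<in> space M \<Longrightarrow> X k \<omega> \<ge> 0"
    by (blast, simp, blast, blast)
  obtain \<omega>0 where \<omega>0: "\<omega>0 \<in> space M" using not_empty by auto
  have "x * (1 + \<delta> 1 \<omega>0 * R 1 \<omega>0) \<ge> 0"
    using rec[of 1 \<omega>0] nn[of 1 \<omega>0] X0[OF \<omega>0] n \<omega>0 by simp
  moreover have "1 + \<delta> 1 \<omega>0 * R 1 \<omega>0 > 0"
    using \<delta>01[of 1 \<omega>0] n \<omega>0 by (intro wealth_factor_pos) auto
  ultimately show x: "x \<ge> 0" by (simp add: zero_le_mult_iff)
  have Xnn: "X k \<omega> \<ge> 0" if "k \<le> n" "\<omega> \<in> space M" for k \<omega>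
    using nn[of k \<omega>] X0[OF that(2)] x that by (cases "k = 0") auto
  have main: "X k \<in> borel_measurable (generated_by M \<xi> {1..k}) \<and>
      (\<integral>\<^sup>+\<omega>. ennreal (X k \<omega> / V k \<omega>) \<partial>M) \<le> ennreal x" if "k \<le> n" for k
    using that
  proof (induction k)
    case 0
    have "X 0 \<in> borel_measurable (generated_by M \<xi> {1..0}) \<longleftrightarrow>
        (\<lambda>_. x) \<in> borel_measurable (generated_by M \<xi> {1..0})"
      by (rule measurable_cong) (simp add: X0)
    moreover have "(\<integral>\<^sup>+\<omega>. ennreal (X 0 \<omega> / V 0 \<omega>) \<partial>M) = (\<integral>\<^sup>+\<omega>. ennreal x \<partial>M)"
      by (rule nn_integral_cong) (simp add: X0 opt_value_def)
    ultimately show ?case by (simp add: emeasure_space_1)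
  next
    case (Suc k)
    then have k: "Suc k \<in> {1..n}" by simp
    let ?F = "generated_by M \<xi> {1..k}"
    have XF [measurable]: "X k \<in> borel_measurable ?F" and IH: "(\<integral>\<^sup>+\<omega>. ennreal (X k \<omega> / V k \<omega>) \<partial>M) \<le> ennreal x"
      using Suc by auto
    have \<delta>F [measurable]: "\<delta> (Suc k) \<in> borel_measurable ?F"
      using \<delta>[OF k] by simp
    have mono: "G \<in> borel_measurable ?F \<Longrightarrow> G \<in> borel_measurable (generated_by M \<xi> {1..Suc k})"
      for G :: "'a \<Rightarrow> real"
      by (rule borel_measurable_generated_by_mono) auto
    have "X (Suc k) \<in> borel_measurable (generated_by M \<xi> {1..Suc k}) \<longleftrightarrow>
        (\<lambda>\<omega>. X k \<omega> * (1 + \<delta> (Suc k) \<omega> * R (Suc k) \<omega>)) \<in> borel_measurable (generated_by M \<xi> {1..Suc k})"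
      by (rule measurable_cong) (simp add: rec[OF k])
    moreover have "R (Suc k) \<in> borel_measurable (generated_by M \<xi> {1..Suc k})"
      by (rule R_measurable_past) simp
    ultimately have meas: "X (Suc k) \<in> borel_measurable (generated_by M \<xi> {1..Suc k})"
      using mono[OF XF] mono[OF \<delta>F] by simp
    \<comment> \<open>Split the relative wealth before trading into the part kept in cash and the part invested.\<close>
    define stay where "stay \<omega> = ennreal (X k \<omega> / V k \<omega> * (1 - \<delta> (Suc k) \<omega>))" for \<omega>
    define invest where "invest \<omega> = ennreal (X k \<omega> / V k \<omega> * \<delta> (Suc k) \<omega>)" for \<omega>
    define ratio where
      "ratio c y = ennreal ((1 + c * (exp (\<mu> (Suc k) - (\<sigma> (Suc k))\<^sup>2 / 2 + \<sigma> (Suc k) * y) - 1)) /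
        (1 + opt (Suc k) * (exp (\<mu> (Suc k) - (\<sigma> (Suc k))\<^sup>2 / 2 + \<sigma> (Suc k) * y) - 1)))" for c y
    have [measurable]: "V k \<in> borel_measurable ?F" by (rule V_measurable_past)
    have past [measurable]: "stay \<in> borel_measurable ?F" "invest \<in> borel_measurable ?F"
      unfolding stay_def[abs_def] invest_def[abs_def] by measurable
    have pastM [measurable]: "stay \<in> borel_measurable M" "invest \<in> borel_measurable M"
      using past by (auto intro: measurable_past_imp)
    have ratio_meas [measurable]: "ratio c \<in> borel_measurable borel" for c
      unfolding ratio_def[abs_def] by measurable
    have ratio_eq: "ratio c (\<xi> (Suc k) \<omega>) = ennreal ((1 + c * R (Suc k) \<omega>) / (1 + opt (Suc k) * R (Suc k) \<omega>))"
      for c \<omega>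
      by (simp add: ratio_def simple_return_def)
    have ratio_le: "(\<integral>\<^sup>+\<omega>. ratio c (\<xi> (Suc k) \<omega>) \<partial>M) \<le> 1" if "0 \<le> c" "c \<le> 1" for c
    proof -
      have "(\<integral>\<^sup>+\<omega>. ratio c (\<xi> (Suc k) \<omega>) \<partial>M) =
          ennreal (expectation (\<lambda>\<omega>. (1 + c * R (Suc k) \<omega>) / (1 + opt (Suc k) * R (Suc k) \<omega>)))"
        unfolding ratio_eq using that
        by (intro nn_integral_eq_integral integrable_ratio AE_I2 divide_nonneg_pos opt_factor_pos
            less_imp_le[OF wealth_factor_pos]) auto
      also have "\<dots> \<le> 1"
        using expectation_ratio_le_1[of "Suc k" c] that by simp
      finally show ?thesis .
    qed
    have bound: "(\<integral>\<^sup>+\<omega>. G \<omega> * ratio c (\<xi> (Suc k) \<omega>) \<partial>M) \<le> (\<integral>\<^sup>+\<omega>. G \<omega> \<partial>M)"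
      if "G \<in> borel_measurable ?F" "0 \<le> c" "c \<le> 1" for G c
    proof -
      have "indep_var borel G borel (\<lambda>\<omega>. ratio c (\<xi> (Suc k) \<omega>))"
        by (rule indep_var_generated_by[OF indep _ _ _ that(1)]) auto
      then show ?thesis
        using mult_left_mono[OF ratio_le[OF that(2,3)], of "\<integral>\<^sup>+\<omega>. G \<omega> \<partial>M"]
        by (simp add: indep_var_nn_integral_mult)
    qed
    have "(\<integral>\<^sup>+\<omega>. ennreal (X (Suc k) \<omega> / V (Suc k) \<omega>) \<partial>M) =
        (\<integral>\<^sup>+\<omega>. stay \<omega> * ratio 0 (\<xi> (Suc k) \<omega>) + invest \<omega> * ratio 1 (\<xi> (Suc k) \<omega>) \<partial>M)"
    proof (rule nn_integral_cong)
      fix \<omega> assume \<omega>: "\<omega> \<in> space M"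
      let ?d = "\<delta> (Suc k) \<omega>" and ?r = "R (Suc k) \<omega>" and ?q = "1 + opt (Suc k) * R (Suc k) \<omega>"
      have q: "?q > 0" by (rule opt_factor_pos) simp
      have d: "0 \<le> ?d" "?d \<le> 1" using \<delta>01[OF k \<omega>] by auto
      have Y: "X k \<omega> / V k \<omega> \<ge> 0"
        using Xnn[OF _ \<omega>, of k] k V_pos[of k \<omega>] by (simp add: less_imp_le)
      have "X (Suc k) \<omega> / V (Suc k) \<omega> = X k \<omega> / V k \<omega> * (1 - ?d) * ((1 + 0 * ?r) / ?q) +
          X k \<omega> / V k \<omega> * ?d * ((1 + 1 * ?r) / ?q)"
        using q V_pos[of k \<omega>] rec[OF k \<omega>] by (simp add: V_Suc divide_simps) (simp add: algebra_simps)
      moreover have nn: "X k \<omega> / V k \<omega> * (1 - ?d) \<ge> 0" "X k \<omega> / V k \<omega> * ?d \<ge> 0"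
          "(1 + 0 * ?r) / ?q \<ge> 0" "(1 + 1 * ?r) / ?q \<ge> 0"
        using d q R_gt[of "Suc k" \<omega>] by (intro mult_nonneg_nonneg[OF Y] divide_nonneg_pos; simp)+
      ultimately have "ennreal (X (Suc k) \<omega> / V (Suc k) \<omega>) =
          ennreal (X k \<omega> / V k \<omega> * (1 - ?d) * ((1 + 0 * ?r) / ?q)) +
          ennreal (X k \<omega> / V k \<omega> * ?d * ((1 + 1 * ?r) / ?q))"
        by (simp only: ennreal_plus[OF mult_nonneg_nonneg[OF nn(1,3)] mult_nonneg_nonneg[OF nn(2,4)]])
      then show "ennreal (X (Suc k) \<omega> / V (Suc k) \<omega>) =
          stay \<omega> * ratio 0 (\<xi> (Suc k) \<omega>) + invest \<omega> * ratio 1 (\<xi> (Suc k) \<omega>)"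
        by (simp only: ratio_eq stay_def invest_def ennreal_mult'[OF nn(1)] ennreal_mult'[OF nn(2)])
    qed
    also have "\<dots> = (\<integral>\<^sup>+\<omega>. stay \<omega> * ratio 0 (\<xi> (Suc k) \<omega>) \<partial>M) + (\<integral>\<^sup>+\<omega>. invest \<omega> * ratio 1 (\<xi> (Suc k) \<omega>) \<partial>M)"
      by (rule nn_integral_add) measurable
    also have "\<dots> \<le> (\<integral>\<^sup>+\<omega>. stay \<omega> \<partial>M) + (\<integral>\<^sup>+\<omega>. invest \<omega> \<partial>M)"
      by (intro add_mono bound past) auto
    also have "\<dots> = (\<integral>\<^sup>+\<omega>. stay \<omega> + invest \<omega> \<partial>M)"
      by (rule nn_integral_add[symmetric]) measurable
    also have "\<dots> = (\<integral>\<^sup>+\<omega>. ennreal (X k \<omega> / V k \<omega>) \<partial>M)"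
    proof (rule nn_integral_cong)
      fix \<omega> assume \<omega>: "\<omega> \<in> space M"
      have "X k \<omega> / V k \<omega> \<ge> 0"
        using Xnn[OF _ \<omega>, of k] k V_pos[of k \<omega>] by (simp add: less_imp_le)
      then have "stay \<omega> + invest \<omega> =
          ennreal (X k \<omega> / V k \<omega> * (1 - \<delta> (Suc k) \<omega>) + X k \<omega> / V k \<omega> * \<delta> (Suc k) \<omega>)"
        unfolding stay_def invest_def using \<delta>01[OF k \<omega>]
        by (intro ennreal_plus[symmetric] mult_nonneg_nonneg) auto
      also have "X k \<omega> / V k \<omega> * (1 - \<delta> (Suc k) \<omega>) + X k \<omega> / V k \<omega> * \<delta> (Suc k) \<omega> = X k \<omega> / V k \<omega>"
        by (simp only: distrib_left[symmetric]) simp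
      finally show "stay \<omega> + invest \<omega> = ennreal (X k \<omega> / V k \<omega>)" .
    qed
    finally show ?case using meas IH by (auto intro: order_trans)
  qed
  show XM [measurable]: "X n \<in> borel_measurable M"
    using main[of n] by (auto intro: measurable_past_imp)
  have nonneg: "AE \<omega> in M. 0 \<le> X n \<omega> / V n \<omega>"
    using Xnn V_pos by (intro AE_I2 divide_nonneg_pos) auto
  show int: "integrable M (\<lambda>\<omega>. X n \<omega> / V n \<omega>)"
    using main[of n] nonneg by (intro integrableI_nonneg) (auto simp: le_less_trans)
  have "ennreal (expectation (\<lambda>\<omega>. X n \<omega> / V n \<omega>)) \<le> ennreal x"
    using main[of n] nn_integral_eq_integral[OF int nonneg] by simp
  then show "expectation (\<lambda>\<omega>. X n \<omega> / V n \<omega>) \<le> x"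
    using x by (simp add: ennreal_le_iff)
qed

lemma constant_fractions_value_process:
  assumes d: "\<And>k. k \<ge> 1 \<Longrightarrow> 0 \<le> d k \<and> d k \<le> 1" and x: "x \<ge> 0"
  shows "(\<lambda>k \<omega>. x * (\<Prod>j=1..k. 1 + d j * R j \<omega>)) \<in> value_processes M \<mu> \<sigma> \<xi> n x"
  unfolding value_processes_def
proof (intro CollectI conjI exI[of _ "\<lambda>k _. d k"] ballI)
  fix k \<omega> assume k: "k \<in> {1..n}"
  then obtain j where "k = Suc j" by (cases k) auto
  then show "x * (\<Prod>j=1..k. 1 + d j * R j \<omega>) = x * (\<Prod>j=1..k - 1. 1 + d j * R j \<omega>) * (1 + d k * R k \<omega>)"
    by simp
  show "0 \<le> x * (\<Prod>j=1..k. 1 + d j * R j \<omega>)"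
    using x d by (intro mult_nonneg_nonneg prod_nonneg less_imp_le[OF wealth_factor_pos]) auto
qed (use d in auto)

text \<open>
  If the wealth started from \<open>1\<close> tends to infinity in probability, the same fractions started from a
  capital that vanishes slowly enough still reach \<open>1\<close> with probability tending to one.
\<close>

lemma SAA_of_divergent_wealth:
  assumes d: "\<And>k. k \<ge> 1 \<Longrightarrow> 0 \<le> d k \<and> d k \<le> 1"
    and lim: "(\<lambda>n. expectation (\<lambda>\<omega>. min 1 (1 / (\<Prod>k=1..n. 1 + d k * R k \<omega>)))) \<longlonglongrightarrow> 0"
  shows "SAA M \<mu> \<sigma> \<xi>"
proof -
  define G where "G n \<omega> = (\<Prod>k=1..n. 1 + d k * R k \<omega>)" for n \<omega>
  define e where "e n = expectation (\<lambda>\<omega>. min 1 (1 / G n \<omega>))" for n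
  \<comment> \<open>Markov's inequality bounds the probability of failure by \<open>e n / x n\<close>, so \<open>sqrt (e n)\<close> is the
    balanced choice; the second summand only keeps the capital positive.\<close>
  define x where "x n = sqrt (e n) + inverse (real (Suc n))" for n
  have G: "G n \<omega> > 0" for n \<omega>
    unfolding G_def using d by (intro prod_pos wealth_factor_pos ballI) auto
  have [measurable]: "G n \<in> borel_measurable M" for n
    unfolding G_def[abs_def] by measurable
  have e0: "e n \<ge> 0" for n
    unfolding e_def using G by (intro integral_nonneg_AE AE_I2) (simp add: less_imp_le)
  have x0: "x n > 0" for n
    using e0[of n] by (auto simp: x_def intro!: add_nonneg_pos)
  have "e \<longlonglongrightarrow> 0" using lim by (simp add: e_def[abs_def] G_def)
  then have se: "(\<lambda>n. sqrt (e n)) \<longlonglongrightarrow> 0"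
    using tendsto_real_sqrt by fastforce
  then have xlim: "x \<longlonglongrightarrow> 0"
    using tendsto_add[OF se LIMSEQ_inverse_real_of_nat] by (simp add: x_def[abs_def])
  have int: "integrable M (\<lambda>\<omega>. min 1 (1 / G n \<omega>))" for n
    by (rule integrable_const_bound[where B = 1]) (use G in \<open>auto simp: less_imp_le abs_le_iff\<close>)
  have low: "1 - sqrt (e n) \<le> \<P>(\<omega> in M. x n * G n \<omega> \<ge> 1)" if "x n \<le> 1" for n
  proof -
    have "\<P>(\<omega> in M. \<not> x n * G n \<omega> \<ge> 1) \<le> \<P>(\<omega> in M. min 1 (1 / G n \<omega>) \<ge> x n)"
    proof (rule finite_measure_mono)
      show "{\<omega> \<in> space M. \<not> 1 \<le> x n * G n \<omega>} \<subseteq> {\<omega> \<in> space M. x n \<le> min 1 (1 / G n \<omega>)}"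
        using G that by (auto simp: field_simps not_le less_imp_le)
    qed measurable
    also have "\<dots> \<le> e n / x n"
      unfolding e_def using int x0 G
      by (intro integral_Markov_inequality_measure[where A = "space M"]) (auto simp: less_imp_le)
    also have "\<dots> \<le> sqrt (e n)"
    proof -
      have "e n = sqrt (e n) * sqrt (e n)" using e0[of n] by simp
      also have "\<dots> \<le> sqrt (e n) * x n"
        using e0[of n] by (intro mult_left_mono) (auto simp: x_def)
      finally show ?thesis using x0[of n] by (simp add: divide_simps)
    qed
    finally have "\<P>(\<omega> in M. \<not> x n * G n \<omega> \<ge> 1) \<le> sqrt (e n)" .
    then show ?thesis
      by (subst (asm) prob_neg) (auto)
  qed
  have "\<forall>\<^sub>F n in sequentially. x n < 1"
    using order_tendstoD(2)[OF xlim] by simp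
  then have low_ev: "\<forall>\<^sub>F n in sequentially. 1 - sqrt (e n) \<le> \<P>(\<omega> in M. x n * G n \<omega> \<ge> 1)"
    by eventually_elim (simp add: low)
  have "(\<lambda>n. \<P>(\<omega> in M. x n * G n \<omega> \<ge> 1)) \<longlonglongrightarrow> 1"
  proof (rule tendsto_sandwich[OF low_ev _ _ tendsto_const])
    show "(\<lambda>n. 1 - sqrt (e n)) \<longlonglongrightarrow> 1"
      using tendsto_diff[OF tendsto_const se, of 1] by simp
  qed simp
  then have "(\<lambda>n. ereal (\<P>(\<omega> in M. x n * G n \<omega> \<ge> 1))) \<longlonglongrightarrow> ereal 1"
    by (rule tendsto_ereal)
  then have "limsup (\<lambda>n. ereal (\<P>(\<omega> in M. x n * G n \<omega> \<ge> 1))) = 1"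
    unfolding one_ereal_def by (rule lim_imp_Limsup[OF trivial_limit_sequentially])
  moreover have "(\<lambda>k \<omega>. x n * G k \<omega>) \<in> value_processes M \<mu> \<sigma> \<xi> n (x n)" for n
    unfolding G_def by (rule constant_fractions_value_process[OF d less_imp_le[OF x0]])
  ultimately show ?thesis
    unfolding SAA_def using xlim by (intro exI[of _ x] exI[of _ "\<lambda>n k \<omega>. x n * G k \<omega>"]) simp
qed

text \<open>
  To reach \<open>1\<close>, a value process must either be large relative to \<open>V\<close>, which Markov's inequality
  makes unlikely when the initial capital is small, or meet a large value of \<open>V\<close>, which is
  unlikely when \<open>V\<close> converges to a finite limit.
\<close>

lemma NAA_of_convergent_V:
  assumes lim: "AE \<omega> in M. \<exists>L>0. (\<lambda>n. 1 / V n \<omega>) \<longlonglongrightarrow> L"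
  shows "NAA M \<mu> \<sigma> \<xi>"
  unfolding NAA_def
proof (intro allI impI)
  fix x :: "nat \<Rightarrow> real" and X
  assume X: "\<forall>n\<ge>1. X n \<in> value_processes M \<mu> \<sigma> \<xi> n (x n)" and xlim: "x \<longlonglongrightarrow> 0"
  \<comment> \<open>A threshold that vanishes, but more slowly than the initial capital; the second summand makes it
    positive also when the capital is zero.\<close>
  define c where "c n = sqrt (x n) + inverse (real (Suc n))" for n
  define I where "I n \<omega> = (indicator {\<omega>\<in>space M. 1 / V n \<omega> < c n} \<omega> :: real)" for n \<omega>
  have [measurable]: "I n \<in> borel_measurable M" for n
    unfolding I_def[abs_def] by measurable
  have sx: "(\<lambda>n. sqrt (x n)) \<longlonglongrightarrow> 0"
    using tendsto_real_sqrt[OF xlim] by simp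
  then have clim: "c \<longlonglongrightarrow> 0"
    using tendsto_add[OF sx LIMSEQ_inverse_real_of_nat] by (simp add: c_def[abs_def])
  have "(\<lambda>n. expectation (I n)) \<longlonglongrightarrow> expectation (\<lambda>_. 0)"
  proof (rule integral_dominated_convergence[where w = "\<lambda>_. 1"])
    show "AE \<omega> in M. (\<lambda>n. I n \<omega>) \<longlonglongrightarrow> 0"
      using lim
    proof eventually_elim
      case (elim \<omega>)
      then obtain L where L: "L > 0" "(\<lambda>n. 1 / V n \<omega>) \<longlonglongrightarrow> L" by blast
      have "(\<lambda>n. 1 / V n \<omega> - c n) \<longlonglongrightarrow> L - 0"
        by (intro tendsto_diff L clim)
      then have "\<forall>\<^sub>F n in sequentially. 0 < 1 / V n \<omega> - c n"
        by (rule order_tendstoD(1)) (use L(1) in simp)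
      then have "\<forall>\<^sub>F n in sequentially. I n \<omega> = 0"
        by eventually_elim (auto simp: I_def)
      then show ?case by (rule tendsto_eventually)
    qed
  qed (auto simp: I_def)
  then have Ilim: "(\<lambda>n. \<P>(\<omega> in M. 1 / V n \<omega> < c n)) \<longlonglongrightarrow> 0"
    by (simp add: I_def[abs_def])
  have up: "\<P>(\<omega> in M. X n n \<omega> \<ge> 1) \<le> sqrt (x n) + \<P>(\<omega> in M. 1 / V n \<omega> < c n)" if n: "n \<ge> 1" for n
  proof -
    note Xn = X[rule_format, OF n]
    have x0: "x n \<ge> 0" using value_process_initial_nonneg[OF Xn n] .
    have c0: "c n > 0" using x0 by (auto simp: c_def intro!: add_nonneg_pos)
    have [measurable]: "X n n \<in> borel_measurable M" using value_process_measurable[OF Xn n] .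
    have Xnn: "X n n \<omega> \<ge> 0" if "\<omega> \<in> space M" for \<omega>
      using Xn n that by (auto simp: value_processes_def)
    have "\<P>(\<omega> in M. X n n \<omega> \<ge> 1) \<le>
        prob ({\<omega>\<in>space M. X n n \<omega> / V n \<omega> \<ge> c n} \<union> {\<omega>\<in>space M. 1 / V n \<omega> < c n})"
    proof (rule finite_measure_mono)
      show "{\<omega> \<in> space M. 1 \<le> X n n \<omega>} \<subseteq>
          {\<omega>\<in>space M. X n n \<omega> / V n \<omega> \<ge> c n} \<union> {\<omega>\<in>space M. 1 / V n \<omega> < c n}"
      proof
        fix \<omega> assume *: "\<omega> \<in> {\<omega> \<in> space M. 1 \<le> X n n \<omega>}"
        then have "1 / V n \<omega> \<le> X n n \<omega> / V n \<omega>"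
          using V_pos[of n \<omega>] by (intro divide_right_mono) auto
        then show "\<omega> \<in> {\<omega>\<in>space M. X n n \<omega> / V n \<omega> \<ge> c n} \<union> {\<omega>\<in>space M. 1 / V n \<omega> < c n}"
          using * by auto
      qed
    qed measurable
    also have "\<dots> \<le> \<P>(\<omega> in M. X n n \<omega> / V n \<omega> \<ge> c n) + \<P>(\<omega> in M. 1 / V n \<omega> < c n)"
      by (rule measure_Un_le) measurable
    also have "\<P>(\<omega> in M. X n n \<omega> / V n \<omega> \<ge> c n) \<le> expectation (\<lambda>\<omega>. X n n \<omega> / V n \<omega>) / c n"
      using integrable_relative_value[OF Xn n] c0 Xnn V_pos
      by (intro integral_Markov_inequality_measure[where A = "space M"] AE_I2 divide_nonneg_pos) auto
    also have "\<dots> \<le> x n / c n"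
      using expectation_relative_value[OF Xn n] c0 by (intro divide_right_mono) auto
    also have "\<dots> \<le> sqrt (x n)"
    proof -
      have "x n = sqrt (x n) * sqrt (x n)" using x0 by simp
      also have "\<dots> \<le> sqrt (x n) * c n"
        using x0 by (intro mult_left_mono) (auto simp: c_def)
      finally show ?thesis using c0 by (simp add: divide_simps)
    qed
    finally show ?thesis by simp
  qed
  have "(\<lambda>n. \<P>(\<omega> in M. X n n \<omega> \<ge> 1)) \<longlonglongrightarrow> 0"
  proof (rule tendsto_sandwich[OF _ _ tendsto_const])
    show "\<forall>\<^sub>F n in sequentially. \<P>(\<omega> in M. X n n \<omega> \<ge> 1) \<le> sqrt (x n) + \<P>(\<omega> in M. 1 / V n \<omega> < c n)"
      using eventually_ge_at_top[of 1] by eventually_elim (rule up)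
    show "(\<lambda>n. sqrt (x n) + \<P>(\<omega> in M. 1 / V n \<omega> < c n)) \<longlonglongrightarrow> 0"
      using tendsto_add[OF sx Ilim] by simp
  qed simp
  then have "(\<lambda>n. ereal (\<P>(\<omega> in M. X n n \<omega> \<ge> 1))) \<longlonglongrightarrow> ereal 0"
    by (rule tendsto_ereal)
  then show "limsup (\<lambda>n. ereal (\<P>(\<omega> in M. X n n \<omega> \<ge> 1))) = 0"
    unfolding zero_ereal_def by (rule lim_imp_Limsup[OF trivial_limit_sequentially])
qed

lemma not_NAA_and_SAA: "\<not> (NAA M \<mu> \<sigma> \<xi> \<and> SAA M \<mu> \<sigma> \<xi>)"
proof
  assume *: "NAA M \<mu> \<sigma> \<xi> \<and> SAA M \<mu> \<sigma> \<xi>"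
  then obtain x X where "\<forall>n\<ge>1. X n \<in> value_processes M \<mu> \<sigma> \<xi> n (x n)" "x \<longlonglongrightarrow> 0"
    and 1: "limsup (\<lambda>n. ereal (\<P>(\<omega> in M. X n n \<omega> \<ge> 1))) = 1"
    unfolding SAA_def by blast
  with * have "limsup (\<lambda>n. ereal (\<P>(\<omega> in M. X n n \<omega> \<ge> 1))) = 0"
    unfolding NAA_def by blast
  with 1 show False by simp
qed

text \<open>The quantity whose summability decides Kakutani's dichotomy for the factors of \<open>1 / V\<close>.\<close>

definition deficit :: "nat \<Rightarrow> real" where
  "deficit k = 1 - expectation (\<lambda>\<omega>. sqrt (1 / (1 + opt k * R k \<omega>)))"

lemma
  shows inverse_V_tendsto_pos: "summable (\<lambda>k. deficit (Suc k)) \<Longrightarrow>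
      AE \<omega> in M. \<exists>L>0. (\<lambda>n. 1 / V n \<omega>) \<longlonglongrightarrow> L"
    and inverse_V_tendsto_zero: "\<not> summable (\<lambda>k. deficit (Suc k)) \<Longrightarrow>
      AE \<omega> in M. (\<lambda>n. 1 / V n \<omega>) \<longlonglongrightarrow> 0"
proof -
  let ?Z = "\<lambda>k \<omega>. 1 / (1 + opt k * R k \<omega>)"
  have indepZ: "indep_vars (\<lambda>_. borel) ?Z {1..}"
    unfolding simple_return_def
    by (rule indep_vars_compose2[OF indep, where Y = "\<lambda>k y. 1 / (1 + opt k *
        (exp (\<mu> k - (\<sigma> k)\<^sup>2 / 2 + \<sigma> k * y) - 1))"]) measurable
  have pos: "?Z k \<omega> > 0" if "k \<ge> 1" for k \<omega>
    using opt_factor_pos[OF that] by simp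
  have int: "integrable M (?Z k)" and le: "expectation (?Z k) \<le> 1" if "k \<ge> 1" for k
    using integrable_ratio[OF that, of 0] expectation_ratio_le_1[OF that, of 0] by simp_all
  have V: "1 / V n \<omega> = (\<Prod>k=1..n. ?Z k \<omega>)" for n \<omega>
    by (simp add: opt_value_def prod_dividef)
  show "AE \<omega> in M. \<exists>L>0. (\<lambda>n. 1 / V n \<omega>) \<longlonglongrightarrow> L" if "summable (\<lambda>k. deficit (Suc k))"
    unfolding V by (rule prod_indep_tendsto_pos[OF indepZ pos int le that[unfolded deficit_def]])
  show "AE \<omega> in M. (\<lambda>n. 1 / V n \<omega>) \<longlonglongrightarrow> 0" if "\<not> summable (\<lambda>k. deficit (Suc k))"
    unfolding V by (rule prod_indep_tendsto_zero[OF indepZ pos int le that[unfolded deficit_def]])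
qed

lemma V_limit_finite:
  assumes "AE \<omega> in M. \<exists>L>0. (\<lambda>n. 1 / V n \<omega>) \<longlonglongrightarrow> L"
  shows "AE \<omega> in M. opt_value_limit M \<mu> \<sigma> \<xi> \<omega> < \<infinity>"
  using assms
proof eventually_elim
  case (elim \<omega>)
  then obtain L where "L > 0" "(\<lambda>n. 1 / V n \<omega>) \<longlonglongrightarrow> L" by blast
  then have "(\<lambda>n. 1 / (1 / V n \<omega>)) \<longlonglongrightarrow> 1 / L"
    by (intro tendsto_divide tendsto_const) auto
  then have "(\<lambda>n. ereal (V n \<omega>)) \<longlonglongrightarrow> ereal (1 / L)"
    by (intro tendsto_ereal) simp
  then have "opt_value_limit M \<mu> \<sigma> \<xi> \<omega> = ereal (1 / L)"
    unfolding opt_value_limit_def by (rule limI)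
  then show ?case by simp
qed

lemma V_limit_infinite:
  assumes "AE \<omega> in M. (\<lambda>n. 1 / V n \<omega>) \<longlonglongrightarrow> 0"
  shows "AE \<omega> in M. opt_value_limit M \<mu> \<sigma> \<xi> \<omega> = \<infinity>"
  using assms
proof eventually_elim
  case (elim \<omega>)
  then have "filterlim (\<lambda>n. inverse (1 / V n \<omega>)) at_top sequentially"
    using V_pos by (intro filterlim_inverse_at_top) auto
  then have "(\<lambda>n. ereal (V n \<omega>)) \<longlonglongrightarrow> \<infinity>"
    by (simp add: tendsto_PInfty_eq_at_top)
  then show ?case
    unfolding opt_value_limit_def by (rule limI)
qed

lemma opt_value_limit_measurable [measurable]: "opt_value_limit M \<mu> \<sigma> \<xi> \<in> borel_measurable M"
  unfolding opt_value_limit_def[abs_def] by measurable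

lemma SAA_of_divergent_V:
  assumes "AE \<omega> in M. (\<lambda>n. 1 / V n \<omega>) \<longlonglongrightarrow> 0"
  shows "SAA M \<mu> \<sigma> \<xi>"
proof (rule SAA_of_divergent_wealth[where d = opt])
  have "(\<lambda>n. expectation (\<lambda>\<omega>. min 1 (1 / V n \<omega>))) \<longlonglongrightarrow> expectation (\<lambda>_. 0)"
  proof (rule integral_dominated_convergence[where w = "\<lambda>_. 1"])
    show "AE \<omega> in M. (\<lambda>n. min 1 (1 / V n \<omega>)) \<longlonglongrightarrow> 0"
      using assms
    proof eventually_elim
      case (elim \<omega>)
      show ?case using tendsto_min[OF tendsto_const elim, of 1] by simp
    qed
    show "AE \<omega> in M. norm (min 1 (1 / V n \<omega>)) \<le> 1" for n
      using V_pos by (intro AE_I2) (auto simp: min_def less_imp_le)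
  qed auto
  then show "(\<lambda>n. expectation (\<lambda>\<omega>. min 1 (1 / (\<Prod>k = 1..n. 1 + opt k * R k \<omega>)))) \<longlonglongrightarrow> 0"
    by (simp add: opt_value_def)
qed (simp add: opt_nonneg opt_le_1)

lemma NAA_SAA_dichotomy:
  shows "NAA M \<mu> \<sigma> \<xi> \<or> SAA M \<mu> \<sigma> \<xi>"
    and "NAA M \<mu> \<sigma> \<xi> \<longleftrightarrow> \<P>(\<omega> in M. opt_value_limit M \<mu> \<sigma> \<xi> \<omega> < \<infinity>) = 1"
    and "SAA M \<mu> \<sigma> \<xi> \<longleftrightarrow> \<P>(\<omega> in M. opt_value_limit M \<mu> \<sigma> \<xi> \<omega> = \<infinity>) = 1"
proof -
  let ?fin = "AE \<omega> in M. opt_value_limit M \<mu> \<sigma> \<xi> \<omega> < \<infinity>"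
  let ?inf = "AE \<omega> in M. opt_value_limit M \<mu> \<sigma> \<xi> \<omega> = \<infinity>"
  have P: "\<P>(\<omega> in M. opt_value_limit M \<mu> \<sigma> \<xi> \<omega> < \<infinity>) = 1 \<longleftrightarrow> ?fin"
    "\<P>(\<omega> in M. opt_value_limit M \<mu> \<sigma> \<xi> \<omega> = \<infinity>) = 1 \<longleftrightarrow> ?inf"
    by (intro prob_Collect_eq_1; measurable)+
  have excl: "\<not> (?fin \<and> ?inf)"
  proof
    assume "?fin \<and> ?inf"
    then have fin: ?fin and inf: ?inf by auto
    from fin inf have "AE \<omega> in M. False" by eventually_elim simp
    then show False by simp
  qed
  have "(NAA M \<mu> \<sigma> \<xi> \<and> ?fin) \<or> (SAA M \<mu> \<sigma> \<xi> \<and> ?inf)"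
    using inverse_V_tendsto_pos inverse_V_tendsto_zero NAA_of_convergent_V V_limit_finite
      SAA_of_divergent_V V_limit_infinite by blast
  then show "NAA M \<mu> \<sigma> \<xi> \<or> SAA M \<mu> \<sigma> \<xi>"
    and "NAA M \<mu> \<sigma> \<xi> \<longleftrightarrow> \<P>(\<omega> in M. opt_value_limit M \<mu> \<sigma> \<xi> \<omega> < \<infinity>) = 1"
    and "SAA M \<mu> \<sigma> \<xi> \<longleftrightarrow> \<P>(\<omega> in M. opt_value_limit M \<mu> \<sigma> \<xi> \<omega> = \<infinity>) = 1"
    unfolding P using excl not_NAA_and_SAA by blast+
qed

end

section \<open>The criterion in terms of drift and volatility\<close>

context lognormal_market
begin

text \<open>Jensen's inequality for the logarithm: \<open>c\<close> is the expected wealth factor.\<close>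

lemma log_growth_le_drift:
  assumes k: "k \<ge> 1" and d: "0 \<le> d" "d \<le> 1"
  shows "expectation (\<lambda>\<omega>. ln (1 + d * R k \<omega>)) \<le> max 0 (\<mu> k)"
proof -
  define m where "m = max 0 (\<mu> k)"
  define c where "c = 1 + d * (exp (\<mu> k) - 1)"
  have c: "0 < c" unfolding c_def using d by (intro one_plus_mult_pos) auto
  have "expectation (\<lambda>\<omega>. ln (1 + d * R k \<omega>)) \<le> expectation (\<lambda>\<omega>. ln c + ((1 + d * R k \<omega>) / c - 1))"
  proof (rule integral_mono)
    show "integrable M (\<lambda>\<omega>. ln c + ((1 + d * R k \<omega>) / c - 1))"
      using integrable_R[OF k] by auto
    fix \<omega>
    have pos: "1 + d * R k \<omega> > 0" using d by (rule wealth_factor_pos)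
    then have "ln ((1 + d * R k \<omega>) / c) \<le> (1 + d * R k \<omega>) / c - 1"
      using c by (intro ln_le_minus_one) auto
    then show "ln (1 + d * R k \<omega>) \<le> ln c + ((1 + d * R k \<omega>) / c - 1)"
      using c pos by (simp add: ln_div)
  qed (rule integrable_ln_factor[OF k d])
  also have "\<dots> = ln c"
    using integrable_R[OF k] expectation_R[OF k] c
    by (simp add: prob_space) (simp add: c_def)
  also have "\<dots> \<le> m"
  proof -
    have "d * (exp (\<mu> k) - 1) \<le> exp m - 1"
    proof (cases "\<mu> k \<ge> 0")
      case True
      then show ?thesis using d mult_right_mono[of d 1 "exp (\<mu> k) - 1"] by (simp add: m_def)
    next
      case False
      then show ?thesis using d by (simp add: m_def mult_nonneg_nonpos)
    qed
    then have "c \<le> exp m" by (simp add: c_def)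
    then show ?thesis using c by (simp add: ln_le_cancel_iff[symmetric, of c "exp m"])
  qed
  finally show ?thesis by (simp add: m_def)
qed

text \<open>
  Half the squared market price of risk is the relative entropy of the real-world measure with respect
  to the martingale measure, and no investment can grow faster. Indeed let \<open>D\<close> be the Girsanov density
  that removes the drift. Then \<open>D\<close> and \<open>(1 + R k) * D\<close> have expectation one, hence so does
  \<open>(1 + d * R k) * D\<close>; as \<open>ln y \<le> y - 1\<close>, the logarithm of this product has expectation at most zero,
  while \<open>- ln D\<close> has expectation \<open>t\<^sup>2 / 2\<close>.
\<close>

lemma log_growth_le_sharpe:
  assumes k: "k \<ge> 1" and d: "0 \<le> d" "d \<le> 1"
  shows "expectation (\<lambda>\<omega>. ln (1 + d * R k \<omega>)) \<le> (\<mu> k / \<sigma> k)\<^sup>2 / 2"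
proof -
  define t where "t = \<mu> k / \<sigma> k"
  have t: "t * \<sigma> k = \<mu> k" using \<sigma>_pos[OF k] by (simp add: t_def)
  define D where "D \<omega> = exp (- (t\<^sup>2 / 2)) * exp ((- t) * \<xi> k \<omega>)" for \<omega>
  note N = integrable_exp_std_normal[OF normal[OF k]] expectation_exp_std_normal[OF normal[OF k]]
  have iD: "integrable M D"
    unfolding D_def[abs_def] by (intro integrable_mult_right N(1))
  have eD: "expectation D = 1"
    unfolding D_def[abs_def] using N(2)[of "- t"] by (simp add: exp_minus)
  have RD: "(1 + R k \<omega>) * D \<omega> = exp (\<mu> k - (\<sigma> k)\<^sup>2 / 2 - t\<^sup>2 / 2) * exp ((\<sigma> k - t) * \<xi> k \<omega>)" for \<omega>
    by (simp add: D_def simple_return_def algebra_simps flip: exp_add)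
  have iRD: "integrable M (\<lambda>\<omega>. (1 + R k \<omega>) * D \<omega>)"
    unfolding RD using N by simp
  have "expectation (\<lambda>\<omega>. (1 + R k \<omega>) * D \<omega>) =
      exp (\<mu> k - (\<sigma> k)\<^sup>2 / 2 - t\<^sup>2 / 2) * exp ((\<sigma> k - t)\<^sup>2 / 2)"
    unfolding RD using N by simp
  also have "\<dots> = exp (\<mu> k - t * \<sigma> k)"
    by (simp add: power2_diff field_simps flip: exp_add)
  finally have eRD: "expectation (\<lambda>\<omega>. (1 + R k \<omega>) * D \<omega>) = 1" using t by simp
  have "expectation (\<lambda>\<omega>. ln (1 + d * R k \<omega>)) \<le>
      expectation (\<lambda>\<omega>. (1 - d) * D \<omega> + d * ((1 + R k \<omega>) * D \<omega>) - 1 + (t\<^sup>2 / 2 + t * \<xi> k \<omega>))"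
  proof (rule integral_mono)
    show "integrable M (\<lambda>\<omega>. (1 - d) * D \<omega> + d * ((1 + R k \<omega>) * D \<omega>) - 1 + (t\<^sup>2 / 2 + t * \<xi> k \<omega>))"
      using iD iRD integrable_std_normal[OF normal[OF k]] by auto
    fix \<omega>
    have pos: "1 + d * R k \<omega> > 0" using d by (rule wealth_factor_pos)
    have "ln ((1 + d * R k \<omega>) * D \<omega>) \<le> (1 + d * R k \<omega>) * D \<omega> - 1"
      using pos by (intro ln_le_minus_one) (auto simp: D_def)
    moreover have "ln ((1 + d * R k \<omega>) * D \<omega>) = ln (1 + d * R k \<omega>) + (- (t\<^sup>2 / 2) - t * \<xi> k \<omega>)"
      using pos by (simp add: D_def ln_mult flip: exp_add)
    moreover have "(1 + d * R k \<omega>) * D \<omega> = (1 - d) * D \<omega> + d * ((1 + R k \<omega>) * D \<omega>)"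
      by (simp add: algebra_simps)
    ultimately show "ln (1 + d * R k \<omega>) \<le>
        (1 - d) * D \<omega> + d * ((1 + R k \<omega>) * D \<omega>) - 1 + (t\<^sup>2 / 2 + t * \<xi> k \<omega>)"
      by linarith
  qed (rule integrable_ln_factor[OF k d])
  also have "\<dots> = t\<^sup>2 / 2"
    using iD iRD eD eRD integrable_std_normal[OF normal[OF k]] expectation_std_normal[OF normal[OF k]]
    by (simp add: prob_space)
  finally show ?thesis by (simp add: t_def)
qed

text \<open>The upper bound is \<open>1 - y \<le> - ln y\<close> for \<open>y\<close> the square root of the inverse optimal factor.\<close>

lemma
  assumes k: "k \<ge> 1"
  shows deficit_nonneg: "deficit k \<ge> 0"
    and deficit_le_log_growth: "deficit k \<le> expectation (\<lambda>\<omega>. ln (1 + opt k * R k \<omega>)) / 2"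
proof -
  let ?Z = "\<lambda>\<omega>. 1 / (1 + opt k * R k \<omega>)"
  have Z: "?Z \<omega> > 0" for \<omega> using opt_factor_pos[OF k] by simp
  have iZ: "integrable M ?Z" and eZ: "expectation ?Z \<le> 1"
    using integrable_ratio[OF k, of 0] expectation_ratio_le_1[OF k, of 0] by simp_all
  show "deficit k \<ge> 0"
    unfolding deficit_def using expectation_sqrt_le_1[OF Z iZ eZ] by simp
  have il: "integrable M (\<lambda>\<omega>. ln (1 + opt k * R k \<omega>))"
    by (rule integrable_ln_factor[OF k opt_nonneg[OF k] opt_le_1[OF k]])
  have "expectation (\<lambda>\<omega>. 1 - ln (1 + opt k * R k \<omega>) / 2) \<le> expectation (\<lambda>\<omega>. sqrt (?Z \<omega>))"
  proof (rule integral_mono)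
    fix \<omega>
    have "ln (sqrt (?Z \<omega>)) \<le> sqrt (?Z \<omega>) - 1"
      using Z[of \<omega>] by (intro ln_le_minus_one real_sqrt_gt_zero)
    moreover have "ln (sqrt (?Z \<omega>)) = - (ln (1 + opt k * R k \<omega>) / 2)"
      using Z[of \<omega>] opt_factor_pos[OF k, of \<omega>] by (simp add: ln_sqrt ln_div)
    ultimately show "1 - ln (1 + opt k * R k \<omega>) / 2 \<le> sqrt (?Z \<omega>)" by linarith
  qed (use il integrable_sqrt[OF Z iZ eZ] in auto)
  then show "deficit k \<le> expectation (\<lambda>\<omega>. ln (1 + opt k * R k \<omega>)) / 2"
    using il by (simp add: deficit_def prob_space)
qed

definition Sigma_summand :: "real \<Rightarrow> nat \<Rightarrow> real" where
  "Sigma_summand \<epsilon> k = (\<mu> k / \<sigma> k)\<^sup>2 * indicator {0<..1/2 * (1 + \<epsilon>) * (\<sigma> k)\<^sup>2} (\<mu> k) +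
    \<mu> k * indicator {1/2 * (1 + \<epsilon>) * (\<sigma> k)\<^sup>2<..} (\<mu> k)"

lemma Sigma_total_eq: "Sigma_total \<mu> \<sigma> \<epsilon> n = (\<Sum>k<n. Sigma_summand \<epsilon> (Suc k))"
  by (simp only: Sigma_total_def Sigma1_def Sigma2_def Sigma_summand_def One_nat_def
      sum.atLeast1_atMost_eq[unfolded One_nat_def] sum.distrib)

lemma Sigma_summand_cases:
  assumes "\<epsilon> > 0" "k \<ge> 1"
  obtains (negative) "\<mu> k \<le> 0" "Sigma_summand \<epsilon> k = 0"
  | (small) "0 < \<mu> k" "\<mu> k \<le> 1/2 * (1 + \<epsilon>) * (\<sigma> k)\<^sup>2" "Sigma_summand \<epsilon> k = (\<mu> k / \<sigma> k)\<^sup>2"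
  | (large) "0 < \<mu> k" "1/2 * (1 + \<epsilon>) * (\<sigma> k)\<^sup>2 < \<mu> k" "Sigma_summand \<epsilon> k = \<mu> k"
proof -
  have "0 < 1/2 * (1 + \<epsilon>) * (\<sigma> k)\<^sup>2"
    using assms \<sigma>_pos[OF assms(2)] by simp
  then show thesis
    using that by (cases "\<mu> k \<le> 0"; cases "\<mu> k \<le> 1/2 * (1 + \<epsilon>) * (\<sigma> k)\<^sup>2")
      (auto simp: Sigma_summand_def)
qed

lemma Sigma_summand_nonneg:
  assumes "\<epsilon> > 0" "k \<ge> 1"
  shows "Sigma_summand \<epsilon> k \<ge> 0"
  using assms by (cases rule: Sigma_summand_cases) auto

lemma deficit_le_summand:
  assumes "\<epsilon> > 0" "k \<ge> 1"
  shows "deficit k \<le> Sigma_summand \<epsilon> k"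
proof -
  note le = log_growth_le_drift[OF assms(2) opt_nonneg opt_le_1, OF assms(2) assms(2)]
    log_growth_le_sharpe[OF assms(2) opt_nonneg opt_le_1, OF assms(2) assms(2)]
    deficit_le_log_growth[OF assms(2)]
  show ?thesis
    using assms
  proof (cases rule: Sigma_summand_cases)
    case small
    have "(\<mu> k / \<sigma> k)\<^sup>2 \<ge> 0" by simp
    then show ?thesis unfolding small(3) using le(2,3) by linarith
  qed (use le in auto)
qed

lemma Sigma_limit_summable:
  assumes "summable (\<lambda>k. Sigma_summand \<epsilon> (Suc k))"
  shows "Sigma_limit \<mu> \<sigma> \<epsilon> < \<infinity>"
proof -
  have "(\<lambda>n. ereal (Sigma_total \<mu> \<sigma> \<epsilon> n)) \<longlonglongrightarrow> ereal (\<Sum>k. Sigma_summand \<epsilon> (Suc k))"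
    unfolding Sigma_total_eq by (intro tendsto_ereal summable_LIMSEQ assms)
  then have "Sigma_limit \<mu> \<sigma> \<epsilon> = ereal (\<Sum>k. Sigma_summand \<epsilon> (Suc k))"
    unfolding Sigma_limit_def by (rule limI)
  then show ?thesis by simp
qed

lemma Sigma_limit_not_summable:
  assumes "\<epsilon> > 0" "\<not> summable (\<lambda>k. Sigma_summand \<epsilon> (Suc k))"
  shows "Sigma_limit \<mu> \<sigma> \<epsilon> = \<infinity>"
proof -
  have "filterlim (\<lambda>n. \<Sum>k<n. Sigma_summand \<epsilon> (Suc k)) at_top sequentially"
    using assms by (intro filterlim_sum_at_top_of_not_summable Sigma_summand_nonneg) auto
  then have "(\<lambda>n. ereal (Sigma_total \<mu> \<sigma> \<epsilon> n)) \<longlonglongrightarrow> \<infinity>"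
    unfolding Sigma_total_eq by (simp add: tendsto_PInfty_eq_at_top)
  then show ?thesis unfolding Sigma_limit_def by (rule limI)
qed

lemma NAA_of_summable:
  assumes "\<epsilon> > 0" "summable (\<lambda>k. Sigma_summand \<epsilon> (Suc k))"
  shows "NAA M \<mu> \<sigma> \<xi>"
proof (rule NAA_of_convergent_V, rule inverse_V_tendsto_pos)
  show "summable (\<lambda>k. deficit (Suc k))"
    by (rule summable_comparison_test'[OF assms(2)])
       (use deficit_nonneg deficit_le_summand[OF assms(1)] in auto)
qed

text \<open>
  Investing everything gives the exponent \<open>- p * \<mu> + p * (p + 1) * \<sigma>\<^sup>2 / 2\<close> for the negative moment of
  order \<open>p\<close>. Since \<open>\<sigma>\<^sup>2 / 2 < \<mu> / (1 + \<epsilon>)\<close>, it is at most \<open>- p * (\<epsilon> - p) / (1 + \<epsilon>) * \<mu>\<close>, and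
  \<open>p = \<epsilon> / 2\<close> maximises \<open>p * (\<epsilon> - p)\<close>. For the inverse itself
  (\<open>p = 1\<close>) the expectation may exceed one.
\<close>

lemma expectation_powr_large_drift:
  assumes k: "k \<ge> 1" and \<epsilon>: "0 < \<epsilon>" and \<mu>: "1/2 * (1 + \<epsilon>) * (\<sigma> k)\<^sup>2 < \<mu> k"
  shows "expectation (\<lambda>\<omega>. (1 + R k \<omega>) powr (- (\<epsilon> / 2))) \<le> exp (- (\<epsilon>\<^sup>2 / (4 * (1 + \<epsilon>)) * \<mu> k))"
proof -
  have "(\<sigma> k)\<^sup>2 / 2 \<le> \<mu> k / (1 + \<epsilon>)"
    using \<mu> \<epsilon> by (simp add: field_simps)
  then have "\<epsilon> / 2 * (\<epsilon> / 2 + 1) * ((\<sigma> k)\<^sup>2 / 2) \<le> \<epsilon> / 2 * (\<epsilon> / 2 + 1) * (\<mu> k / (1 + \<epsilon>))"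
    using \<epsilon> by (intro mult_left_mono) auto
  then have "- (\<epsilon> / 2) * \<mu> k + - (\<epsilon> / 2) * (- (\<epsilon> / 2) - 1) * (\<sigma> k)\<^sup>2 / 2 \<le>
      - (\<epsilon> / 2) * \<mu> k + \<epsilon> / 2 * (\<epsilon> / 2 + 1) * (\<mu> k / (1 + \<epsilon>))"
    by (simp add: algebra_simps)
  also have "\<dots> = - (\<epsilon>\<^sup>2 / (4 * (1 + \<epsilon>)) * \<mu> k)"
    using \<epsilon> by (simp add: divide_simps power2_eq_square) (simp add: algebra_simps)
  finally show ?thesis
    unfolding expectation_powr[OF k] by simp
qed

text \<open>Convexity of \<open>p \<mapsto> y powr (- p)\<close> between \<open>0\<close> and \<open>1\<close>.\<close>

lemma powr_minus_le:
  fixes y p :: real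
  assumes "y > 0" "0 < p" "p \<le> 1"
  shows "y powr (- p) \<le> 1 - p + p * (1 / y)"
proof -
  have "exp ((1 - p) *\<^sub>R 0 + p *\<^sub>R (- ln y)) \<le> (1 - p) * exp 0 + p * exp (- ln y)"
    using assms by (intro convex_onD[OF exp_convex]) auto
  then show ?thesis
    using assms by (simp add: powr_def exp_minus field_simps)
qed

text \<open>
  By \<open>1 / (1 + x) \<le> 1 - x + 2 * x\<^sup>2\<close> for \<open>x \<ge> - 1/2\<close>, and since \<open>\<mu> \<le> \<sigma>\<^sup>2 \<le> 1\<close> gives
  \<open>E R \<ge> \<mu>\<close> and \<open>E (R\<^sup>2) \<le> 22 * \<sigma>\<^sup>2\<close>, the expectation is at most \<open>1 - d * \<mu> + 44 * d\<^sup>2 * \<sigma>\<^sup>2\<close>. The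
  fraction \<open>\<mu> / (88 * \<sigma>\<^sup>2)\<close> minimises this bound.
\<close>

lemma expectation_inverse_small_drift:
  assumes k: "k \<ge> 1" and \<mu>: "0 < \<mu> k" "\<mu> k \<le> (\<sigma> k)\<^sup>2" and \<sigma>1: "\<sigma> k \<le> 1"
  defines "d \<equiv> \<mu> k / (88 * (\<sigma> k)\<^sup>2)"
  shows "integrable M (\<lambda>\<omega>. 1 / (1 + d * R k \<omega>))"
    and "expectation (\<lambda>\<omega>. 1 / (1 + d * R k \<omega>)) \<le> 1 - (\<mu> k / \<sigma> k)\<^sup>2 / 176"
    and "0 \<le> d" "d \<le> 1"
proof -
  define s where "s = (\<sigma> k)\<^sup>2"
  have s: "0 < s" "s \<le> 1"
    using \<sigma>_pos[OF k] \<sigma>1 by (auto simp: s_def power_le_one)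
  have ms: "\<mu> k \<le> s" using \<mu> by (simp add: s_def)
  have d: "0 \<le> d" "d \<le> 1/2"
    using s \<mu> ms by (simp_all add: d_def s_def[symmetric] field_simps)
  then show d01: "0 \<le> d" "d \<le> 1" by auto
  have dR: "d * R k \<omega> \<ge> - (1/2)" for \<omega>
    using mult_left_mono[of "-1" "R k \<omega>" d] R_gt[of k \<omega>] d by simp
  have pt: "1 / (1 + d * R k \<omega>) \<le> 1 - d * R k \<omega> + 2 * (d * R k \<omega>)\<^sup>2" for \<omega>
  proof -
    let ?x = "d * R k \<omega>"
    have "1 \<le> (1 - ?x + 2 * ?x\<^sup>2) * (1 + ?x)"
    proof -
      have "0 \<le> ?x\<^sup>2 * (1 + 2 * ?x)" using dR[of \<omega>] by (intro mult_nonneg_nonneg) auto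
      then show ?thesis by (simp add: power2_eq_square algebra_simps)
    qed
    then show ?thesis using dR[of \<omega>] by (simp add: pos_divide_le_eq)
  qed
  note iR = integrable_R[OF k] integrable_R_square[OF k]
  have [measurable]: "R k \<in> borel_measurable M" using k by simp
  show int: "integrable M (\<lambda>\<omega>. 1 / (1 + d * R k \<omega>))"
  proof (rule Bochner_Integration.integrable_bound)
    show "integrable M (\<lambda>\<omega>. 1 + 1 / (1 + R k \<omega>))" using integrable_inverse_R[OF k] by auto
    show "AE \<omega> in M. norm (1 / (1 + d * R k \<omega>)) \<le> norm (1 + 1 / (1 + R k \<omega>))"
    proof (rule AE_I2)
      fix \<omega>
      have "1 / (1 + d * R k \<omega>) > 0" using wealth_factor_pos[OF d01] by simp
      then show "norm (1 / (1 + d * R k \<omega>)) \<le> norm (1 + 1 / (1 + R k \<omega>))"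
        using inverse_one_plus_mult_le[OF d01 R_gt, of k \<omega>] by simp
    qed
  qed measurable
  have "expectation (\<lambda>\<omega>. 1 / (1 + d * R k \<omega>)) \<le>
      expectation (\<lambda>\<omega>. 1 - d * R k \<omega> + 2 * d\<^sup>2 * (R k \<omega>)\<^sup>2)"
    using iR int pt by (intro integral_mono) (auto simp: power_mult_distrib mult.assoc)
  also have "\<dots> = 1 - d * expectation (R k) + 2 * d\<^sup>2 * expectation (\<lambda>\<omega>. (R k \<omega>)\<^sup>2)"
    using iR by (simp add: prob_space)
  also have "\<dots> \<le> 1 - d * \<mu> k + 2 * d\<^sup>2 * (22 * s)"
  proof -
    have ex: "exp y - 1 \<le> 2 * y" if "0 \<le> y" "y \<le> 1" for y :: real
    proof -
      have "exp y \<le> 1 + y + y\<^sup>2" using that by (rule exp_bound)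
      moreover have "y * y \<le> y * 1" using that by (intro mult_left_mono)
      ultimately show ?thesis by (simp add: power2_eq_square)
    qed
    have "\<mu> k \<le> expectation (R k)"
      unfolding expectation_R[OF k] using exp_ge_add_one_self[of "\<mu> k"] by linarith
    moreover have "expectation (\<lambda>\<omega>. (R k \<omega>)\<^sup>2) \<le> 22 * s"
    proof -
      have "exp (\<mu> k) - 1 \<le> 2 * s" using ex[of "\<mu> k"] \<mu> ms s by simp
      then have "(exp (\<mu> k) - 1)\<^sup>2 \<le> (2 * s)\<^sup>2" using \<mu> by (intro power_mono) auto
      also have "\<dots> \<le> 4 * s"
        using s mult_left_mono[of s 1 s] by (simp add: power2_eq_square)
      finally have 1: "(exp (\<mu> k) - 1)\<^sup>2 \<le> 4 * s" .
      have "exp (2 * \<mu> k) \<le> exp (1 + 1)" using ms s by simp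
      also have "\<dots> \<le> 3 * 3" unfolding exp_add by (intro mult_mono exp_le) auto
      finally have "exp (2 * \<mu> k) * (exp s - 1) \<le> 9 * (2 * s)"
        using ex[of s] s by (intro mult_mono) auto
      with 1 show ?thesis unfolding expectation_R_square[OF k] by (simp add: s_def)
    qed
    ultimately show ?thesis using d
      by (intro add_mono diff_left_mono mult_left_mono) auto
  qed
  also have "\<dots> = 1 - (\<mu> k / \<sigma> k)\<^sup>2 / 176"
    using s by (simp add: d_def s_def[symmetric] power_divide power_mult_distrib divide_simps)
      (simp add: power2_eq_square algebra_simps)
  finally show "expectation (\<lambda>\<omega>. 1 / (1 + d * R k \<omega>)) \<le> 1 - (\<mu> k / \<sigma> k)\<^sup>2 / 176" .
qed

text \<open>
  A strategy with explicit fractions suffices: everything when the drift is large, a small multiple of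
  \<open>\<mu> / \<sigma>\<^sup>2\<close> when the drift is small and the volatility at most \<open>1\<close>, nothing otherwise. In each period
  its wealth factor has a negative moment of order \<open>p\<close> below \<open>exp (- c * s)\<close>, where \<open>s\<close> is the
  summand of the period, with finitely many exceptions caused by a small drift at large volatility.
  By independence the negative moment of the wealth tends to zero.
\<close>

lemma SAA_of_not_summable:
  assumes \<epsilon>: "0 < \<epsilon>" "\<epsilon> < 1" and nsum: "\<not> summable (\<lambda>k. Sigma_summand \<epsilon> (Suc k))"
    and lim: "(\<lambda>k. \<sigma> k * indicator {0<..1/2 * (1 + \<epsilon>) * (\<sigma> k)\<^sup>2} (\<mu> k)) \<longlonglongrightarrow> 0"
  shows "SAA M \<mu> \<sigma> \<xi>"
proof -
  define p where "p = \<epsilon> / 2"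
  define c where "c = min (\<epsilon>\<^sup>2 / (4 * (1 + \<epsilon>))) (p / 176)"
  define d where "d k = (if 1/2 * (1 + \<epsilon>) * (\<sigma> k)\<^sup>2 < \<mu> k then 1
    else if 0 < \<mu> k \<and> \<sigma> k \<le> 1 then \<mu> k / (88 * (\<sigma> k)\<^sup>2) else 0)" for k
  define Y where "Y k \<omega> = (1 + d k * R k \<omega>) powr (- p)" for k \<omega>
  have p: "0 < p" "p \<le> 1" using \<epsilon> by (auto simp: p_def)
  have c: "c > 0" "c \<le> \<epsilon>\<^sup>2 / (4 * (1 + \<epsilon>))" "c \<le> p / 176"
    using \<epsilon> p unfolding c_def by (simp, intro min.cobounded1, intro min.cobounded2)
  obtain K where K: "\<And>k. k \<ge> K \<Longrightarrow> \<sigma> k * indicator {0<..1/2 * (1 + \<epsilon>) * (\<sigma> k)\<^sup>2} (\<mu> k) < 1"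
    using order_tendstoD(2)[OF lim, of 1] by (auto simp: eventually_sequentially)
  \<comment> \<open>The first \<open>K\<close> periods may contain the exceptions; there only the bound \<open>1\<close> is claimed.\<close>
  define r where "r k = (if k < K then 0 else Sigma_summand \<epsilon> (Suc k))" for k
  have Y: "0 \<le> d k \<and> d k \<le> 1 \<and> integrable M (Y k) \<and> expectation (Y k) \<le> 1 \<and>
      (\<sigma> k \<le> 1 \<or> \<not> (0 < \<mu> k \<and> \<mu> k \<le> 1/2 * (1 + \<epsilon>) * (\<sigma> k)\<^sup>2) \<longrightarrow>
        expectation (Y k) \<le> exp (- (c * Sigma_summand \<epsilon> k)))" if k: "k \<ge> 1" for k
    using \<epsilon>(1) k
  proof (cases rule: Sigma_summand_cases)
    case negative
    have "0 < 1/2 * (1 + \<epsilon>) * (\<sigma> k)\<^sup>2" using \<epsilon> \<sigma>_pos[OF k] by simp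
    then have "d k = 0" using negative by (simp add: d_def)
    moreover from this have "Y k = (\<lambda>_. 1)" by (simp add: Y_def[abs_def])
    ultimately show ?thesis using negative by (simp add: prob_space)
  next
    case small
    show ?thesis
    proof (cases "\<sigma> k \<le> 1")
      case True
      have d: "d k = \<mu> k / (88 * (\<sigma> k)\<^sup>2)" using small True by (simp add: d_def)
      have "1/2 * (1 + \<epsilon>) * (\<sigma> k)\<^sup>2 \<le> 1 * (\<sigma> k)\<^sup>2"
        using \<epsilon> by (intro mult_right_mono) auto
      then have "\<mu> k \<le> (\<sigma> k)\<^sup>2" using small by simp
      note inv = expectation_inverse_small_drift[OF k small(1) this True, folded d]
      define z where "z \<omega> = 1 / (1 + d k * R k \<omega>)" for \<omega>
      have iz: "integrable M z" and Ez: "expectation z \<le> 1 - (\<mu> k / \<sigma> k)\<^sup>2 / 176"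
        using inv(1,2) by (simp_all add: z_def[abs_def])
      have Y_le: "Y k \<omega> \<le> 1 - p + p * z \<omega>" for \<omega>
        unfolding Y_def z_def using inv(3,4) p by (intro powr_minus_le wealth_factor_pos)
      have int: "integrable M (Y k)"
      proof (rule Bochner_Integration.integrable_bound)
        show "integrable M (\<lambda>\<omega>. 1 - p + p * z \<omega>)"
          using iz by simp
        have [measurable]: "R k \<in> borel_measurable M" using k by simp
        show "Y k \<in> borel_measurable M" unfolding Y_def[abs_def] by measurable
        show "AE \<omega> in M. norm (Y k \<omega>) \<le> norm (1 - p + p * z \<omega>)"
          using Y_le by (intro AE_I2) (smt (verit) Y_def powr_ge_zero real_norm_def)
      qed
      have "expectation (Y k) \<le> expectation (\<lambda>\<omega>. 1 - p + p * z \<omega>)"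
        using int iz Y_le by (intro integral_mono) auto
      also have "\<dots> = 1 - p + p * expectation z"
        using iz by (simp add: prob_space)
      also have "\<dots> \<le> 1 - p + p * (1 - (\<mu> k / \<sigma> k)\<^sup>2 / 176)"
        using Ez p by (intro add_left_mono mult_left_mono) auto
      also have "\<dots> = 1 - p / 176 * Sigma_summand \<epsilon> k"
        unfolding small(3) by (simp add: algebra_simps)
      also have "\<dots> \<le> 1 - c * Sigma_summand \<epsilon> k"
        using c(3) Sigma_summand_nonneg[OF \<epsilon>(1) k] by (intro diff_left_mono mult_right_mono)
      finally have le: "expectation (Y k) \<le> 1 - c * Sigma_summand \<epsilon> k" .
      also have "\<dots> \<le> exp (- (c * Sigma_summand \<epsilon> k))"
        using exp_ge_add_one_self[of "- (c * Sigma_summand \<epsilon> k)"] by simp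
      finally have "expectation (Y k) \<le> exp (- (c * Sigma_summand \<epsilon> k))" .
      moreover have "expectation (Y k) \<le> 1"
        using le mult_nonneg_nonneg[of c "Sigma_summand \<epsilon> k"] c(1) Sigma_summand_nonneg[OF \<epsilon>(1) k] by linarith
      ultimately show ?thesis using int inv(3,4) by blast
    next
      case False
      then have "d k = 0" using small by (simp add: d_def)
      moreover from this have "Y k = (\<lambda>_. 1)" by (simp add: Y_def[abs_def])
      ultimately show ?thesis using small False by (simp add: prob_space)
    qed
  next
    case large
    then have d: "d k = 1" by (simp add: d_def)
    have Yk: "Y k = (\<lambda>\<omega>. (1 + R k \<omega>) powr (- (\<epsilon> / 2)))"
      by (simp add: Y_def[abs_def] d p_def)
    have "expectation (Y k) \<le> exp (- (\<epsilon>\<^sup>2 / (4 * (1 + \<epsilon>)) * \<mu> k))"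
      unfolding Yk by (rule expectation_powr_large_drift[OF k \<epsilon>(1) large(2)])
    also have "\<dots> \<le> exp (- (c * Sigma_summand \<epsilon> k))"
      unfolding large(3) using mult_right_mono[OF c(2), of "\<mu> k"] large(1) by simp
    finally have le: "expectation (Y k) \<le> exp (- (c * Sigma_summand \<epsilon> k))" .
    also have "\<dots> \<le> 1" using c(1) Sigma_summand_nonneg[OF \<epsilon>(1) k] by simp
    finally show ?thesis using le d integrable_powr[OF k] by (simp add: Yk)
  qed
  have d01: "0 \<le> d k \<and> d k \<le> 1" and Yint: "integrable M (Y k)" if "k \<ge> 1" for k
    using Y[OF that] by blast+
  have EY: "expectation (Y (Suc k)) \<le> exp (- (c * r k))" for k
  proof (cases "k < K")
    case True
    then show ?thesis using Y[of "Suc k"] by (simp add: r_def)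
  next
    case False
    then have "\<sigma> (Suc k) \<le> 1 \<or> \<not> (0 < \<mu> (Suc k) \<and> \<mu> (Suc k) \<le> 1/2 * (1 + \<epsilon>) * (\<sigma> (Suc k))\<^sup>2)"
      using K[of "Suc k"] by (auto simp: indicator_def split: if_splits)
    then show ?thesis using Y[of "Suc k"] False by (auto simp: r_def)
  qed
  have Yind: "indep_vars (\<lambda>_. borel) Y {1..}"
    unfolding Y_def simple_return_def
    by (rule indep_vars_compose2[OF indep, where Y = "\<lambda>k y. (1 + d k *
        (exp (\<mu> k - (\<sigma> k)\<^sup>2 / 2 + \<sigma> k * y) - 1)) powr (- p)"]) measurable
  have Ynn: "Y k \<omega> \<ge> 0" for k \<omega> by (simp add: Y_def)
  show ?thesis
  proof (rule SAA_of_divergent_wealth[OF d01])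
    let ?m = "\<lambda>n \<omega>. min 1 (1 / (\<Prod>k=1..n. 1 + d k * R k \<omega>))"
    have G: "(\<Prod>k=1..n. 1 + d k * R k \<omega>) > 0" for n \<omega>
      using d01 by (intro prod_pos wealth_factor_pos ballI) auto
    have mY: "?m n \<omega> \<le> (\<Prod>k=1..n. Y k \<omega>)" for n \<omega>
    proof -
      define z where "z = 1 / (\<Prod>k=1..n. 1 + d k * R k \<omega>)"
      have z: "z > 0" using G by (simp add: z_def)
      have "min 1 z \<le> z powr p"
      proof (cases "z \<ge> 1")
        case True
        then show ?thesis using ge_one_powr_ge_zero[of z p] p by simp
      next
        case False
        then have "z powr 1 \<le> z powr p" using z p by (intro powr_mono') auto
        then show ?thesis using z by simp
      qed
      also have "z powr p = (\<Prod>k=1..n. 1 + d k * R k \<omega>) powr (- p)"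
        using G[of \<omega> n] by (simp add: z_def powr_minus powr_divide inverse_eq_divide)
      also have "\<dots> = (\<Prod>k=1..n. Y k \<omega>)"
        unfolding Y_def
        by (rule prod_powr_distrib)
      finally show ?thesis by (simp add: z_def)
    qed
    have E: "expectation (\<lambda>\<omega>. \<Prod>k=1..n. Y k \<omega>) = (\<Prod>k=1..n. expectation (Y k))"
      and I: "integrable M (\<lambda>\<omega>. \<Prod>k=1..n. Y k \<omega>)" for n
      by (auto intro!: indep_vars_lebesgue_integral indep_vars_integrable
          indep_vars_subset[OF Yind] Yint)
    have up: "expectation (?m n) \<le> exp (- (c * (\<Sum>k<n. r k)))" for n
    proof -
      have "expectation (?m n) \<le> expectation (\<lambda>\<omega>. \<Prod>k=1..n. Y k \<omega>)"
      proof (rule integral_mono)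
        show "integrable M (?m n)"
          by (rule integrable_const_bound[where B = 1])
             (use G[of _ n] in \<open>auto simp: less_imp_le abs_le_iff min_def\<close>)
      qed (intro I mY)+
      also have "\<dots> = (\<Prod>k<n. expectation (Y (Suc k)))"
        unfolding E by (simp add: prod.atLeast1_atMost_eq)
      also have "\<dots> \<le> (\<Prod>k<n. exp (- (c * r k)))"
        using EY Ynn by (intro prod_mono) auto
      also have "\<dots> = exp (- (c * (\<Sum>k<n. r k)))"
        by (simp add: exp_sum sum_distrib_left flip: sum_negf)
      finally show ?thesis .
    qed
    have "\<forall>\<^sub>F k in sequentially. r k = Sigma_summand \<epsilon> (Suc k)"
      using eventually_ge_at_top[of K] by eventually_elim (simp add: r_def)
    then have "\<not> summable r" using nsum by (simp add: summable_cong)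
    moreover have "r k \<ge> 0" for k
      using Sigma_summand_nonneg[OF \<epsilon>(1)] by (simp add: r_def)
    ultimately have "filterlim (\<lambda>n. \<Sum>k<n. r k) at_top sequentially"
      by (intro filterlim_sum_at_top_of_not_summable)
    then have "filterlim (\<lambda>n. c * (\<Sum>k<n. r k)) at_top sequentially"
      by (rule filterlim_tendsto_pos_mult_at_top[OF tendsto_const c(1)])
    then have lim0: "(\<lambda>n. exp (- (c * (\<Sum>k<n. r k)))) \<longlonglongrightarrow> 0"
      by (intro filterlim_compose[OF exp_at_bot] filterlim_compose[OF filterlim_uminus_at_bot_at_top])
    show "(\<lambda>n. expectation (?m n)) \<longlonglongrightarrow> 0"
    proof (rule tendsto_sandwich[OF _ _ tendsto_const lim0])
      show "\<forall>\<^sub>F n in sequentially. 0 \<le> expectation (?m n)"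
        using G by (intro always_eventually allI integral_nonneg_AE AE_I2) (simp add: less_imp_le)
      show "\<forall>\<^sub>F n in sequentially. expectation (?m n) \<le> exp (- (c * (\<Sum>k<n. r k)))"
        using up by (intro always_eventually allI)
    qed
  qed
qed

lemma NAA_SAA_criterion:
  assumes \<epsilon>: "0 < \<epsilon>" "\<epsilon> < 1"
    and lim: "(\<lambda>k. \<sigma> k * indicator {0<..1/2 * (1 + \<epsilon>) * (\<sigma> k)\<^sup>2} (\<mu> k)) \<longlonglongrightarrow> 0"
  shows "NAA M \<mu> \<sigma> \<xi> \<longleftrightarrow> Sigma_limit \<mu> \<sigma> \<epsilon> < \<infinity>"
    and "SAA M \<mu> \<sigma> \<xi> \<longleftrightarrow> Sigma_limit \<mu> \<sigma> \<epsilon> = \<infinity>"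
proof -
  have "(NAA M \<mu> \<sigma> \<xi> \<and> Sigma_limit \<mu> \<sigma> \<epsilon> < \<infinity>) \<or> (SAA M \<mu> \<sigma> \<xi> \<and> Sigma_limit \<mu> \<sigma> \<epsilon> = \<infinity>)"
    using NAA_of_summable[OF \<epsilon>(1)] Sigma_limit_summable SAA_of_not_summable[OF \<epsilon> _ lim]
      Sigma_limit_not_summable[OF \<epsilon>(1)] by blast
  then show "NAA M \<mu> \<sigma> \<xi> \<longleftrightarrow> Sigma_limit \<mu> \<sigma> \<epsilon> < \<infinity>"
    and "SAA M \<mu> \<sigma> \<xi> \<longleftrightarrow> Sigma_limit \<mu> \<sigma> \<epsilon> = \<infinity>"
    using not_NAA_and_SAA by auto
qed

end

theorem theorem6p2:
  fixes M :: "'a measure" and \<xi> :: "nat \<Rightarrow> 'a \<Rightarrow> real" and \<mu> \<sigma> :: "nat \<Rightarrow> real"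
  assumes "prob_space M"
    and "prob_space.indep_vars M (\<lambda>_. borel) \<xi> {1..}"
    and "\<And>k. k \<ge> 1 \<Longrightarrow> distributed M lborel (\<xi> k) std_normal_density"
    and "sets M = sets (generated_by M \<xi> {1..})"
    and "\<And>k. k \<ge> 1 \<Longrightarrow> \<sigma> k > 0"
  shows "((NAA M \<mu> \<sigma> \<xi> \<or> SAA M \<mu> \<sigma> \<xi>) \<and> \<not> (NAA M \<mu> \<sigma> \<xi> \<and> SAA M \<mu> \<sigma> \<xi>)) \<and>
      (NAA M \<mu> \<sigma> \<xi> \<longleftrightarrow> \<P>(\<omega> in M. opt_value_limit M \<mu> \<sigma> \<xi> \<omega> < \<infinity>) = 1) \<and>
      (SAA M \<mu> \<sigma> \<xi> \<longleftrightarrow> \<P>(\<omega> in M. opt_value_limit M \<mu> \<sigma> \<xi> \<omega> = \<infinity>) = 1) \<and>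
    (\<forall>\<epsilon>\<in>{0<..<1}.
      (\<lambda>k. \<sigma> k * indicator {0<..1/2 * (1 + \<epsilon>) * (\<sigma> k)\<^sup>2} (\<mu> k)) \<longlonglongrightarrow> 0 \<longrightarrow>
      (NAA M \<mu> \<sigma> \<xi> \<longleftrightarrow> Sigma_limit \<mu> \<sigma> \<epsilon> < \<infinity>) \<and>
      (SAA M \<mu> \<sigma> \<xi> \<longleftrightarrow> Sigma_limit \<mu> \<sigma> \<epsilon> = \<infinity>))"
proof -
  interpret prob_space M by (rule assms(1))
  interpret lognormal_market M \<xi> \<mu> \<sigma>
    by unfold_locales (use assms(2,3,5) in auto)
  show ?thesis
    using NAA_SAA_dichotomy not_NAA_and_SAA NAA_SAA_criterion by simp
qed

end
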